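(* Let $\Lambda$ and $H$ be countable (discrete) groups, and assume that $\Lambda$ has at least two elements. (i) $\Lambda\wr H$ is MAP if and only if $\Lambda$ is MAP, $H$ is RF, and either $H$ is finite or $\Lambda$ is abelian. (ii) (Gruenberg) $\Lambda\wr H$ is RF if and only if $\Lambda$ and $H$ are both RF, and either $H$ is finite or $\Lambda$ is abelian.
   Context: A topological group $G$ is maximally almost periodic (MAP) if its irreducible finite dimensional unitary representations (continuous homomorphisms $\pi:G\to U(n)$, $n\ge1$, irreducible) separate the points of $G$. $G$ is residually finite (RF) if its irreducible finite dimensional unitary representations with finite image separate the points of $G$. Here all groups are discrete. The wreath product $\Lambda\wr H$ is the semi-direct product $(\bigoplus_{h\in H}\Lambda)\rtimes H$, where $\bigoplus_{h\in H}\Lambda$ is the group of finitely supported families and $H$ acts by shifting the indices. *)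

theory Defs
  imports
    "HOL-Library.Countable_Set"
    "HOL-Algebra.Product_Groups"
    "Jordan_Normal_Form.Schur_Decomposition"
    "Jordan_Normal_Form.VS_Connect"
begin

definition unitary_group :: "nat \<Rightarrow> complex mat monoid" where
  "unitary_group n =
    \<lparr> carrier = {A \<in> carrier_mat n n. A * mat_adjoint A = 1\<^sub>m n \<and> mat_adjoint A * A = 1\<^sub>m n},
      monoid.mult = (*),
      one = 1\<^sub>m n \<rparr>"

text \<open>
  Groups are discrete throughout, so every homomorphism into the unitary group is continuous.
\<close>

definition unitary_rep :: "('a, 'b) monoid_scheme \<Rightarrow> nat \<Rightarrow> ('a \<Rightarrow> complex mat) \<Rightarrow> bool" where
  "unitary_rep G n \<pi> \<longleftrightarrow> 1 \<le> n \<and> \<pi> \<in> hom G (unitary_group n)"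

definition invariant_subspace ::
    "('a, 'b) monoid_scheme \<Rightarrow> nat \<Rightarrow> ('a \<Rightarrow> complex mat) \<Rightarrow> complex vec set \<Rightarrow> bool" where
  "invariant_subspace G n \<pi> W \<longleftrightarrow>
    VectorSpace.subspace class_ring W (module_vec TYPE(complex) n) \<and>
    (\<forall>g\<in>carrier G. \<forall>w\<in>W. \<pi> g *\<^sub>v w \<in> W)"

definition irreducible_unitary_rep ::
    "('a, 'b) monoid_scheme \<Rightarrow> nat \<Rightarrow> ('a \<Rightarrow> complex mat) \<Rightarrow> bool" where
  "irreducible_unitary_rep G n \<pi> \<longleftrightarrow>
    unitary_rep G n \<pi> \<and>
    (\<forall>W. invariant_subspace G n \<pi> W \<longrightarrow> W = {0\<^sub>v n} \<or> W = carrier_vec n)"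

definition maximally_almost_periodic :: "('a, 'b) monoid_scheme \<Rightarrow> bool" where
  "maximally_almost_periodic G \<longleftrightarrow>
    (\<forall>x\<in>carrier G. \<forall>y\<in>carrier G. x \<noteq> y \<longrightarrow>
      (\<exists>n \<pi>. irreducible_unitary_rep G n \<pi> \<and> \<pi> x \<noteq> \<pi> y))"

definition residually_finite :: "('a, 'b) monoid_scheme \<Rightarrow> bool" where
  "residually_finite G \<longleftrightarrow>
    (\<forall>x\<in>carrier G. \<forall>y\<in>carrier G. x \<noteq> y \<longrightarrow>
      (\<exists>n \<pi>. irreducible_unitary_rep G n \<pi> \<and> finite (\<pi> ` carrier G) \<and> \<pi> x \<noteq> \<pi> y))"

definition semidirect_product ::
    "('a, 'b) monoid_scheme \<Rightarrow> ('c, 'd) monoid_scheme \<Rightarrow> ('c \<Rightarrow> 'a \<Rightarrow> 'a) \<Rightarrow> ('a \<times> 'c) monoid" where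
  "semidirect_product N H \<alpha> =
    \<lparr> carrier = carrier N \<times> carrier H,
      monoid.mult = (\<lambda>(a, h) (b, k). (a \<otimes>\<^bsub>N\<^esub> \<alpha> h b, h \<otimes>\<^bsub>H\<^esub> k)),
      one = (\<one>\<^bsub>N\<^esub>, \<one>\<^bsub>H\<^esub>) \<rparr>"

definition shift_action :: "('c, 'd) monoid_scheme \<Rightarrow> 'c \<Rightarrow> ('c \<Rightarrow> 'a) \<Rightarrow> 'c \<Rightarrow> 'a" where
  "shift_action H h f = (\<lambda>x\<in>carrier H. f (inv\<^bsub>H\<^esub> h \<otimes>\<^bsub>H\<^esub> x))"

definition wreath_product ::
    "('a, 'b) monoid_scheme \<Rightarrow> ('c, 'd) monoid_scheme \<Rightarrow> (('c \<Rightarrow> 'a) \<times> 'c) monoid" where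
  "wreath_product L H =
    semidirect_product (sum_group (carrier H) (\<lambda>_. L)) H (shift_action H)"

lemma carrier_wreath_product:
  assumes "group L"
  shows "carrier (wreath_product L H) =
    {f \<in> carrier H \<rightarrow>\<^sub>E carrier L. finite {h \<in> carrier H. f h \<noteq> \<one>\<^bsub>L\<^esub>}} \<times> carrier H"
  using assms by (simp add: wreath_product_def semidirect_product_def carrier_sum_group)

lemma shift_action_closed:
  assumes "group L" "group H" and h: "h \<in> carrier H"
    and f: "f \<in> carrier (sum_group (carrier H) (\<lambda>_. L))"
  shows "shift_action H h f \<in> carrier (sum_group (carrier H) (\<lambda>_. L))"
proof -
  interpret H: group H by fact
  have "{x \<in> carrier H. f (inv\<^bsub>H\<^esub> h \<otimes>\<^bsub>H\<^esub> x) \<noteq> \<one>\<^bsub>L\<^esub>}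
      \<subseteq> (\<lambda>y. h \<otimes>\<^bsub>H\<^esub> y) ` {y \<in> carrier H. f y \<noteq> \<one>\<^bsub>L\<^esub>}"
  proof
    fix x assume x: "x \<in> {x \<in> carrier H. f (inv\<^bsub>H\<^esub> h \<otimes>\<^bsub>H\<^esub> x) \<noteq> \<one>\<^bsub>L\<^esub>}"
    then have "x = h \<otimes>\<^bsub>H\<^esub> (inv\<^bsub>H\<^esub> h \<otimes>\<^bsub>H\<^esub> x)"
      using h by (simp add: H.m_assoc[symmetric])
    then show "x \<in> (\<lambda>y. h \<otimes>\<^bsub>H\<^esub> y) ` {y \<in> carrier H. f y \<noteq> \<one>\<^bsub>L\<^esub>}"
      using x h by blast
  qed
  moreover have "finite {y \<in> carrier H. f y \<noteq> \<one>\<^bsub>L\<^esub>}"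
    using f assms(1) by (simp add: carrier_sum_group)
  ultimately have "finite {x \<in> carrier H. f (inv\<^bsub>H\<^esub> h \<otimes>\<^bsub>H\<^esub> x) \<noteq> \<one>\<^bsub>L\<^esub>}"
    by (meson finite_imageI finite_subset)
  then have "finite {x \<in> carrier H. shift_action H h f x \<noteq> \<one>\<^bsub>L\<^esub>}"
    by (rule rev_finite_subset) (auto simp: shift_action_def)
  moreover have "shift_action H h f \<in> carrier H \<rightarrow>\<^sub>E carrier L"
    using f h assms(1) by (auto simp: shift_action_def carrier_sum_group PiE_iff)
  ultimately show ?thesis
    using assms(1) by (simp add: carrier_sum_group)
qed

lemma group_wreath_product:
  assumes L: "group L" and H: "group H"
  shows "group (wreath_product L H)"
proof -
  interpret L: group L by fact
  interpret H: group H by fact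
  define S where "S = sum_group (carrier H) (\<lambda>_. L)"
  interpret S: group S
    unfolding S_def using L by simp
  have ext: "f \<in> carrier H \<rightarrow>\<^sub>E carrier L" if "f \<in> carrier S" for f
    using that L by (simp add: S_def carrier_sum_group)
  have mult_S: "f \<otimes>\<^bsub>S\<^esub> g = (\<lambda>x\<in>carrier H. f x \<otimes>\<^bsub>L\<^esub> g x)" for f g
    by (simp add: S_def)
  have closed: "shift_action H h f \<in> carrier S" if "h \<in> carrier H" "f \<in> carrier S" for h f
    using shift_action_closed[OF L H] that by (simp add: S_def)
  have shift_mult: "shift_action H h (f \<otimes>\<^bsub>S\<^esub> g) = shift_action H h f \<otimes>\<^bsub>S\<^esub> shift_action H h g"
    if "h \<in> carrier H" for h f g
    using that by (auto simp: mult_S shift_action_def fun_eq_iff)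
  have shift_shift: "shift_action H h (shift_action H k f) = shift_action H (h \<otimes>\<^bsub>H\<^esub> k) f"
    if "h \<in> carrier H" "k \<in> carrier H" for h k f
    using that by (auto simp: shift_action_def fun_eq_iff H.inv_mult_group H.m_assoc)
  have shift_one: "shift_action H \<one>\<^bsub>H\<^esub> f = f" if "f \<in> carrier S" for f
    using ext[OF that] by (auto simp: shift_action_def fun_eq_iff PiE_iff extensional_def)
  have W: "wreath_product L H = semidirect_product S H (shift_action H)"
    by (simp add: wreath_product_def S_def)
  show ?thesis
    unfolding W
  proof (rule groupI)
    fix x assume x: "x \<in> carrier (semidirect_product S H (shift_action H))"
    then obtain f h where fh: "x = (f, h)" "f \<in> carrier S" "h \<in> carrier H"
      by (auto simp: semidirect_product_def)
    have inv: "inv\<^bsub>H\<^esub> h \<in> carrier H" using fh by simp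
    have "shift_action H (inv\<^bsub>H\<^esub> h) (inv\<^bsub>S\<^esub> f) \<otimes>\<^bsub>S\<^esub> shift_action H (inv\<^bsub>H\<^esub> h) f
        = shift_action H (inv\<^bsub>H\<^esub> h) \<one>\<^bsub>S\<^esub>"
      using fh inv by (simp add: shift_mult[symmetric] S.l_inv)
    also have "\<dots> = \<one>\<^bsub>S\<^esub>"
      using inv fh by (auto simp: S_def shift_action_def fun_eq_iff)
    finally show "\<exists>y\<in>carrier (semidirect_product S H (shift_action H)).
        y \<otimes>\<^bsub>semidirect_product S H (shift_action H)\<^esub> x
          = \<one>\<^bsub>semidirect_product S H (shift_action H)\<^esub>"
      using fh inv
      by (intro bexI[of _ "(shift_action H (inv\<^bsub>H\<^esub> h) (inv\<^bsub>S\<^esub> f), inv\<^bsub>H\<^esub> h)"])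
        (auto simp: semidirect_product_def closed)
  qed (auto simp: semidirect_product_def closed shift_one shift_mult shift_shift
        S.m_assoc H.m_assoc)
qed

end

theory Submission
  imports Defs "HOL-Algebra.Free_Abelian_Groups" "Jordan_Normal_Form.Spectral_Radius"
begin

text \<open>
  Unitary representations are completely reducible, so both properties only ask that every element
  \<open>g \<noteq> \<one>\<close> acts nontrivially in some finite dimensional unitary representation, with finite image in the
  case of residual finiteness (\<open>separates_points_iff\<close>). The two parts are then the same statement with
  and without the condition on images, and they are proved together (\<open>separated_wreath_iff\<close>).

  Let \<open>\<pi>\<close> be a unitary representation of the wreath product, and write \<open>\<delta> k a\<close> for the element \<open>a\<close> of
  \<open>L\<close> placed at the position \<open>k\<close> of \<open>H\<close>. For fixed \<open>a\<close> the unitary matrices \<open>\<pi> (\<delta> k a)\<close> commute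
  pairwise and are conjugate under \<open>H\<close>, so they can be diagonalised simultaneously and have the same
  eigenvalues. Hence there are only finitely many of them (\<open>finite_rep_\<delta>\<close>). Two conclusions follow. The
  group \<open>H\<close> acts on this finite set, and if \<open>\<pi>\<close> separates \<open>\<delta> h a\<close> from \<open>\<delta> \<one> a\<close>, the stabiliser of a
  point is a subgroup of finite index that does not contain \<open>h\<close>; so \<open>H\<close> is residually finite. If \<open>H\<close> is infinite,
  then \<open>\<pi> (\<delta> \<one> a) = \<pi> (\<delta> j a)\<close> for some \<open>j \<noteq> \<one>\<close>, and the right-hand side commutes with every
  \<open>\<pi> (\<delta> \<one> b)\<close>; so \<open>L\<close> is abelian. The property of \<open>L\<close> itself is inherited from the wreath product.

  Conversely, elements with a nontrivial component in \<open>H\<close> are separated from \<open>\<one>\<close> by representations of \<open>H\<close>.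
  An element of the base group is a family \<open>f\<close> with some \<open>f k \<noteq> \<one>\<close>. For a subgroup \<open>N\<close> of finite
  index in \<open>H\<close>, the product of the entries over the coset of \<open>k\<close> is a homomorphism from the semidirect
  product of the base group with \<open>N\<close> to \<open>L\<close>, provided that \<open>L\<close> is abelian or \<open>N\<close> is trivial. By residual
  finiteness \<open>N\<close> can be chosen such that the coset meets the support of \<open>f\<close> in \<open>k\<close> only, and then \<open>f\<close> is
  mapped to \<open>f k\<close>. A representation of \<open>L\<close> not killing \<open>f k\<close> is pulled back and then induced to the wreath
  product; induction from a subgroup of finite index stays within finite dimensional unitary
  representations and preserves finiteness of the image (\<open>induced_rep\<close>).
\<close>

section \<open>Adjoints and the unitary group\<close>

lemma mat_adjoint_dim [simp]:
  "dim_row (mat_adjoint A) = dim_col A" "dim_col (mat_adjoint A) = dim_row A"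
  unfolding mat_adjoint_def by auto

lemma mat_adjoint_carrier [simp]: "A \<in> carrier_mat n m \<Longrightarrow> mat_adjoint A \<in> carrier_mat m n"
  by (intro carrier_matI) auto

lemma mat_adjoint_index [simp]:
  fixes A :: "'a::conjugatable_field mat"
  assumes "i < dim_col A" "j < dim_row A"
  shows "mat_adjoint A $$ (i, j) = conjugate (A $$ (j, i))"
  using assms unfolding mat_adjoint_def by (simp add: mat_of_rows_index)

lemma mat_adjoint_adjoint [simp]:
  fixes A :: "'a::conjugatable_field mat"
  shows "mat_adjoint (mat_adjoint A) = A"
  by (rule eq_matI) auto

lemma mat_adjoint_one [simp]: "mat_adjoint (1\<^sub>m n :: complex mat) = 1\<^sub>m n"
  by (rule eq_matI) auto

lemma mat_adjoint_mult:
  fixes A B :: "'a::conjugatable_field mat"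
  assumes "dim_col A = dim_row B"
  shows "mat_adjoint (A * B) = mat_adjoint B * mat_adjoint A"
proof (rule eq_matI)
  fix i j assume "i < dim_row (mat_adjoint B * mat_adjoint A)" "j < dim_col (mat_adjoint B * mat_adjoint A)"
  then have ij: "i < dim_col B" "j < dim_row A" by auto
  have "mat_adjoint (A * B) $$ (i, j) = (\<Sum>l = 0..<dim_row B. conjugate (A $$ (j, l) * B $$ (l, i)))"
    using ij assms by (simp add: scalar_prod_def sum_conjugate)
  also have "\<dots> = (\<Sum>l = 0..<dim_row B. conjugate (B $$ (l, i)) * conjugate (A $$ (j, l)))"
    by (simp add: conjugate_dist_mul mult.commute)
  also have "\<dots> = (mat_adjoint B * mat_adjoint A) $$ (i, j)"
    using ij assms by (simp add: scalar_prod_def)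
  finally show "mat_adjoint (A * B) $$ (i, j) = (mat_adjoint B * mat_adjoint A) $$ (i, j)" .
qed auto

text \<open>
  Associativity with side conditions on dimensions rather than on carriers, so that the
  simplifier can discharge them without guessing the intermediate dimensions.
\<close>

lemma mat_assoc:
  fixes A B C :: "'a::semiring_0 mat"
  assumes "dim_col A = dim_row B" "dim_col B = dim_row C"
  shows "A * B * C = A * (B * C)"
  by (rule assoc_mult_mat[of _ "dim_row A" "dim_row B" _ "dim_col B" _ "dim_col C"])
    (use assms in auto)

lemma mat_vec_assoc:
  fixes A B :: "'a::semiring_0 mat"
  assumes "dim_col A = dim_row B" "dim_col B = dim_vec v"
  shows "A * B *\<^sub>v v = A *\<^sub>v (B *\<^sub>v v)"
  by (rule assoc_mult_mat_vec[of _ "dim_row A" "dim_row B" _ "dim_col B"])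
    (use assms in \<open>auto intro: carrier_vecI\<close>)

text \<open>
  In products bracketed to the right by \<open>mat_assoc\<close>, a relation between two adjacent factors applies only
  after it has been extended by the factors to the right of them.
\<close>

lemma mat_cancel_left:
  fixes A B C X :: "'a::semiring_0 mat"
  assumes "A * B = X" "dim_col A = dim_row B" "dim_col B = dim_row C"
  shows "A * (B * C) = X * C"
  by (metis mat_assoc[OF assms(2,3)] assms(1))

lemma unitary_group_simps:
  "A \<in> carrier (unitary_group n) \<longleftrightarrow>
    A \<in> carrier_mat n n \<and> A * mat_adjoint A = 1\<^sub>m n \<and> mat_adjoint A * A = 1\<^sub>m n"
  "A \<otimes>\<^bsub>unitary_group n\<^esub> B = A * B"
  "\<one>\<^bsub>unitary_group n\<^esub> = 1\<^sub>m n"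
  by (auto simp: unitary_group_def)

lemma unitary_carrier: "A \<in> carrier (unitary_group n) \<Longrightarrow> A \<in> carrier_mat n n"
  by (simp add: unitary_group_simps)

lemma group_unitary_group: "group (unitary_group n)"
proof (rule groupI)
  fix A B assume A: "A \<in> carrier (unitary_group n)" and B: "B \<in> carrier (unitary_group n)"
  note d = unitary_carrier[OF A] unitary_carrier[OF B]
  have "A * B * (mat_adjoint B * mat_adjoint A) = A * (B * mat_adjoint B) * mat_adjoint A"
    "mat_adjoint B * mat_adjoint A * (A * B) = mat_adjoint B * (mat_adjoint A * A) * B"
    using d by (auto simp: mat_assoc)
  then show "A \<otimes>\<^bsub>unitary_group n\<^esub> B \<in> carrier (unitary_group n)"
    using A B d by (auto simp: unitary_group_simps mat_adjoint_mult)
next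
  fix A assume A: "A \<in> carrier (unitary_group n)"
  show "\<exists>B\<in>carrier (unitary_group n). B \<otimes>\<^bsub>unitary_group n\<^esub> A = \<one>\<^bsub>unitary_group n\<^esub>"
    using A by (intro bexI[of _ "mat_adjoint A"]) (auto simp: unitary_group_simps)
qed (auto simp: unitary_group_simps mat_assoc)

lemma unitary_inv:
  assumes "A \<in> carrier (unitary_group n)"
  shows "inv\<^bsub>unitary_group n\<^esub> A = mat_adjoint A"
  using assms by (intro group.inv_equality[OF group_unitary_group])
    (auto simp: unitary_group_simps)

lemma unitary_repD:
  assumes "group G" "unitary_rep G n \<pi>"
  shows "g \<in> carrier G \<Longrightarrow> \<pi> g \<in> carrier (unitary_group n)"
    and "g \<in> carrier G \<Longrightarrow> \<pi> g \<in> carrier_mat n n"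
    and "g \<in> carrier G \<Longrightarrow> h \<in> carrier G \<Longrightarrow> \<pi> (g \<otimes>\<^bsub>G\<^esub> h) = \<pi> g * \<pi> h"
    and "\<pi> \<one>\<^bsub>G\<^esub> = 1\<^sub>m n"
    and "g \<in> carrier G \<Longrightarrow> \<pi> (inv\<^bsub>G\<^esub> g) = mat_adjoint (\<pi> g)"
    and "g \<in> carrier G \<Longrightarrow> \<pi> g * mat_adjoint (\<pi> g) = 1\<^sub>m n"
    and "g \<in> carrier G \<Longrightarrow> mat_adjoint (\<pi> g) * \<pi> g = 1\<^sub>m n"
proof -
  interpret group_hom G "unitary_group n" \<pi>
    using assms group_unitary_group by (auto simp: group_hom_def group_hom_axioms_def unitary_rep_def)
  show c: "g \<in> carrier G \<Longrightarrow> \<pi> g \<in> carrier (unitary_group n)" by simp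
  then show "g \<in> carrier G \<Longrightarrow> \<pi> g \<in> carrier_mat n n" by (rule unitary_carrier)
  show "g \<in> carrier G \<Longrightarrow> h \<in> carrier G \<Longrightarrow> \<pi> (g \<otimes>\<^bsub>G\<^esub> h) = \<pi> g * \<pi> h"
    by (simp add: unitary_group_simps)
  show "\<pi> \<one>\<^bsub>G\<^esub> = 1\<^sub>m n" by (simp add: unitary_group_simps)
  show "g \<in> carrier G \<Longrightarrow> \<pi> (inv\<^bsub>G\<^esub> g) = mat_adjoint (\<pi> g)" by (simp add: unitary_inv)
  show "g \<in> carrier G \<Longrightarrow> \<pi> g * mat_adjoint (\<pi> g) = 1\<^sub>m n"
    "g \<in> carrier G \<Longrightarrow> mat_adjoint (\<pi> g) * \<pi> g = 1\<^sub>m n" using c by (auto simp: unitary_group_simps)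
qed

lemma unitary_repI:
  assumes "group G" "1 \<le> n"
    and c: "\<And>g. g \<in> carrier G \<Longrightarrow> \<pi> g \<in> carrier_mat n n"
    and m: "\<And>g h. g \<in> carrier G \<Longrightarrow> h \<in> carrier G \<Longrightarrow> \<pi> (g \<otimes>\<^bsub>G\<^esub> h) = \<pi> g * \<pi> h"
    and one: "\<pi> \<one>\<^bsub>G\<^esub> = 1\<^sub>m n"
    and adj: "\<And>g. g \<in> carrier G \<Longrightarrow> \<pi> (inv\<^bsub>G\<^esub> g) = mat_adjoint (\<pi> g)"
  shows "unitary_rep G n \<pi>"
proof -
  interpret group G by fact
  have "\<pi> g * mat_adjoint (\<pi> g) = 1\<^sub>m n" "mat_adjoint (\<pi> g) * \<pi> g = 1\<^sub>m n" if "g \<in> carrier G" for g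
    using m[of g "inv\<^bsub>G\<^esub> g"] m[of "inv\<^bsub>G\<^esub> g" g] one adj that by auto
  then show ?thesis
    using assms by (auto simp: unitary_rep_def hom_def unitary_group_simps)
qed

lemma unitary_rep_comp:
  assumes "unitary_rep G n \<pi>" "\<phi> \<in> hom K G"
  shows "unitary_rep K n (\<lambda>x. \<pi> (\<phi> x))"
  using assms by (auto simp: unitary_rep_def hom_def Pi_iff)

section \<open>Orthonormal bases of subspaces\<close>

text \<open>
  A matrix with orthonormal columns cannot have more columns than rows: padded with zero rows it would
  be a square matrix with a left inverse, hence with a right inverse, although it has a zero row.
\<close>

lemma isometry_dim_le:
  fixes U :: "'a::conjugatable_field mat"
  assumes U: "U \<in> carrier_mat n k" and iso: "mat_adjoint U * U = 1\<^sub>m k"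
  shows "k \<le> n"
proof (rule ccontr)
  assume kn: "\<not> k \<le> n"
  define A where "A = mat k k (\<lambda>(i, j). if i < n then U $$ (i, j) else 0)"
  have A: "A \<in> carrier_mat k k" "dim_row A = k" "dim_col A = k" by (auto simp: A_def)
  have "mat_adjoint A * A = mat_adjoint U * U"
  proof (rule eq_matI)
    fix i j assume "i < dim_row (mat_adjoint U * U)" "j < dim_col (mat_adjoint U * U)"
    then have ij: "i < k" "j < k" using U by auto
    have "(mat_adjoint A * A) $$ (i, j) = (\<Sum>l = 0..<k. conjugate (A $$ (l, i)) * A $$ (l, j))"
      using ij A by (simp add: scalar_prod_def)
    also have "\<dots> = (\<Sum>l = 0..<n. conjugate (U $$ (l, i)) * U $$ (l, j))"
      using ij kn by (intro sum.mono_neutral_cong_right) (auto simp: A_def)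
    also have "\<dots> = (mat_adjoint U * U) $$ (i, j)"
      using ij U by (auto simp: scalar_prod_def)
    finally show "(mat_adjoint A * A) $$ (i, j) = (mat_adjoint U * U) $$ (i, j)" .
  qed (use U A in auto)
  then have "A * mat_adjoint A = 1\<^sub>m k"
    using iso mat_mult_left_right_inverse[OF mat_adjoint_carrier[OF A(1)] A(1)] by simp
  then have "(A * mat_adjoint A) $$ (n, n) = 1" using kn by simp
  moreover have "(A * mat_adjoint A) $$ (n, n) = 0"
    using kn A by (simp add: scalar_prod_def) (simp add: A_def)
  ultimately show False by simp
qed

lemma isometry_image_inj:
  fixes U :: "'a::conjugatable_field mat"
  assumes U: "U \<in> carrier_mat n k" and iso: "mat_adjoint U * U = 1\<^sub>m k" and x: "x \<in> carrier_vec k"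
  shows "mat_adjoint U *\<^sub>v (U *\<^sub>v x) = x"
  using assms by (simp flip: assoc_mult_mat_vec[OF mat_adjoint_carrier[OF U] U x])

lemma mat_eq_by_vectors:
  fixes A B :: "'a::comm_ring_1 mat"
  assumes A: "A \<in> carrier_mat n k" and B: "B \<in> carrier_mat n k"
    and eq: "\<And>x. x \<in> carrier_vec k \<Longrightarrow> A *\<^sub>v x = B *\<^sub>v x"
  shows "A = B"
proof (rule eq_matI)
  fix i j assume "i < dim_row B" "j < dim_col B"
  then have ij: "i < n" "j < k" using B by auto
  have "A *\<^sub>v unit_vec k j = col A j" "B *\<^sub>v unit_vec k j = col B j"
    using A B ij by auto
  then have "col A j = col B j" using eq[of "unit_vec k j"] by simp
  then show "A $$ (i, j) = B $$ (i, j)"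
    using A B ij by (metis carrier_matD index_col)
qed (use A B in auto)

lemma subspace_vecD:
  assumes "VectorSpace.subspace class_ring W (module_vec TYPE(complex) n)"
  shows "W \<subseteq> carrier_vec n" "0\<^sub>v n \<in> W"
    "v \<in> W \<Longrightarrow> w \<in> W \<Longrightarrow> v + w \<in> W"
    "v \<in> W \<Longrightarrow> c \<cdot>\<^sub>v v \<in> W"
  using assms unfolding VectorSpace.subspace_def submodule_def by (auto simp: module_vec_simps)

lemma subspace_vecI:
  assumes "W \<subseteq> carrier_vec n" "0\<^sub>v n \<in> W"
    "\<And>v w. v \<in> W \<Longrightarrow> w \<in> W \<Longrightarrow> v + w \<in> W"
    "\<And>v c. v \<in> W \<Longrightarrow> c \<cdot>\<^sub>v v \<in> W"
  shows "VectorSpace.subspace class_ring W (module_vec TYPE(complex) n)"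
  unfolding VectorSpace.subspace_def submodule_def
  using assms vec_vs vec_module by (auto simp: module_vec_simps)

text \<open>
  An isometry stands for the subspace spanned by its orthonormal columns. The case \<open>k = 0\<close> is
  included and stands for the zero subspace.
\<close>

definition isometry :: "nat \<Rightarrow> nat \<Rightarrow> complex mat \<Rightarrow> bool" where
  "isometry n k U \<longleftrightarrow> U \<in> carrier_mat n k \<and> mat_adjoint U * U = 1\<^sub>m k"

lemma adjoint_mult_index:
  fixes A B :: "complex mat"
  assumes "A \<in> carrier_mat n k" "B \<in> carrier_mat n m" "i < k" "j < m"
  shows "(mat_adjoint A * B) $$ (i, j) = (\<Sum>l = 0..<n. cnj (A $$ (l, i)) * B $$ (l, j))"
  using assms by (auto simp: scalar_prod_def)

lemma mult_mat_vec_carrier_dim: "dim_row A = k \<Longrightarrow> A *\<^sub>v v \<in> carrier_vec k"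
  by (rule carrier_vecI) simp

text \<open>
  One step of the Gram--Schmidt process: a nonzero vector orthogonal to all columns is normalised and
  appended as a last column. The scalar \<open>c\<close> is the normalising factor.
\<close>

lemma isometry_extend:
  assumes U: "isometry n k U" and d: "d \<in> carrier_vec n" "d \<noteq> 0\<^sub>v n"
    and orth: "mat_adjoint U *\<^sub>v d = 0\<^sub>v k"
  obtains V c where "isometry n (Suc k) V"
    "\<And>x. x \<in> carrier_vec (Suc k) \<Longrightarrow> V *\<^sub>v x = U *\<^sub>v vec k (\<lambda>i. x $ i) + (c * x $ k) \<cdot>\<^sub>v d"
proof -
  define N where "N = (\<Sum>l = 0..<n. (cmod (d $ l))\<^sup>2)"
  obtain l where l: "l < n" "d $ l \<noteq> 0" using d by (metis carrier_vecD eq_vecI index_zero_vec)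
  have "0 < (cmod (d $ l))\<^sup>2" using l by simp
  also have "\<dots> \<le> N" unfolding N_def by (rule member_le_sum) (use l in auto)
  finally have N: "N > 0" .
  define c :: complex where "c = complex_of_real (1 / sqrt N)"
  have cnjd: "cnj z * z = complex_of_real ((cmod z)\<^sup>2)" for z
    by (metis complex_norm_square mult.commute)
  have cc: "cnj c * c * complex_of_real N = 1"
  proof -
    have "1 / sqrt N * (1 / sqrt N) * N = 1" using N by (simp add: field_simps)
    then show ?thesis unfolding c_def by (metis complex_cnj_complex_of_real of_real_1 of_real_mult)
  qed
  define V where "V = mat n (Suc k) (\<lambda>(i, j). if j < k then U $$ (i, j) else c * d $ i)"
  have Uc: "U \<in> carrier_mat n k" and UU: "mat_adjoint U * U = 1\<^sub>m k" using U by (auto simp: isometry_def)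
  have V: "V \<in> carrier_mat n (Suc k)" by (simp add: V_def)
  have Ud: "(\<Sum>l = 0..<n. cnj (U $$ (l, i)) * d $ l) = 0" if "i < k" for i
  proof -
    have "(mat_adjoint U *\<^sub>v d) $ i = (\<Sum>l = 0..<n. cnj (U $$ (l, i)) * d $ l)"
      using that Uc d by (auto simp: scalar_prod_def)
    then show ?thesis using orth that by simp
  qed
  have "mat_adjoint V * V = 1\<^sub>m (Suc k)"
  proof (rule eq_matI)
    fix i j assume "i < dim_row (1\<^sub>m (Suc k) :: complex mat)" "j < dim_col (1\<^sub>m (Suc k) :: complex mat)"
    then have ij: "i < Suc k" "j < Suc k" by auto
    have e: "(mat_adjoint V * V) $$ (i, j) = (\<Sum>l = 0..<n. cnj (V $$ (l, i)) * V $$ (l, j))"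
      by (rule adjoint_mult_index[OF V V ij])
    consider "i < k" "j < k" | "i < k" "j = k" | "i = k" "j < k" | "i = k" "j = k" using ij by linarith
    then have "(\<Sum>l = 0..<n. cnj (V $$ (l, i)) * V $$ (l, j)) = (if i = j then 1 else 0)"
    proof cases
      case 1
      then have "(\<Sum>l = 0..<n. cnj (V $$ (l, i)) * V $$ (l, j)) = (mat_adjoint U * U) $$ (i, j)"
        by (simp add: adjoint_mult_index[OF Uc Uc] V_def)
      then show ?thesis using 1 UU by simp
    next
      case 2
      then have "(\<Sum>l = 0..<n. cnj (V $$ (l, i)) * V $$ (l, j))
          = (\<Sum>l = 0..<n. c * (cnj (U $$ (l, i)) * d $ l))"
        by (auto simp: V_def mult_ac intro!: sum.cong)
      then show ?thesis using 2 Ud by (simp flip: sum_distrib_left)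
    next
      case 3
      then have "(\<Sum>l = 0..<n. cnj (V $$ (l, i)) * V $$ (l, j))
          = (\<Sum>l = 0..<n. cnj (c * (cnj (U $$ (l, j)) * d $ l)))"
        by (auto simp: V_def mult_ac intro!: sum.cong)
      also have "\<dots> = cnj (c * (\<Sum>l = 0..<n. cnj (U $$ (l, j)) * d $ l))"
        unfolding sum_distrib_left by (simp only: cnj_sum)
      finally show ?thesis using 3 Ud by simp
    next
      case 4
      then have "(\<Sum>l = 0..<n. cnj (V $$ (l, i)) * V $$ (l, j))
          = (\<Sum>l = 0..<n. cnj c * c * complex_of_real ((cmod (d $ l))\<^sup>2))"
        unfolding cnjd[symmetric] by (auto simp: V_def mult_ac intro!: sum.cong)
      also have "\<dots> = cnj c * c * complex_of_real N"
        unfolding N_def by (simp add: sum_distrib_left)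
      finally show ?thesis using 4 cc by simp
    qed
    then show "(mat_adjoint V * V) $$ (i, j) = 1\<^sub>m (Suc k) $$ (i, j)" using e ij by simp
  qed (use V in auto)
  moreover have "V *\<^sub>v x = U *\<^sub>v vec k (\<lambda>i. x $ i) + (c * x $ k) \<cdot>\<^sub>v d"
    if x: "x \<in> carrier_vec (Suc k)" for x
  proof (rule eq_vecI)
    fix i assume "i < dim_vec (U *\<^sub>v vec k (\<lambda>i. x $ i) + (c * x $ k) \<cdot>\<^sub>v d)"
    then have i: "i < n" using d by simp
    have "(V *\<^sub>v x) $ i = (\<Sum>j = 0..<Suc k. V $$ (i, j) * x $ j)"
      using i V x by (auto simp: scalar_prod_def)
    also have "\<dots> = (\<Sum>j = 0..<k. U $$ (i, j) * x $ j) + c * d $ i * x $ k"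
      using i by (simp add: V_def)
    also have "\<dots> = (U *\<^sub>v vec k (\<lambda>i. x $ i) + (c * x $ k) \<cdot>\<^sub>v d) $ i"
      using i Uc d by (auto simp: scalar_prod_def)
    finally show "(V *\<^sub>v x) $ i = (U *\<^sub>v vec k (\<lambda>i. x $ i) + (c * x $ k) \<cdot>\<^sub>v d) $ i" .
  qed (use V Uc d in auto)
  ultimately show thesis using that V by (auto simp: isometry_def)
qed

text \<open>
  The number of columns of isometries with range inside \<open>W\<close> is bounded by \<open>n\<close>. A longest one has range
  all of \<open>W\<close>, since for \<open>w\<close> in \<open>W\<close> outside of the range the component of \<open>w\<close> orthogonal to the range
  would allow one more column.
\<close>

lemma subspace_isometry:
  assumes W: "VectorSpace.subspace class_ring W (module_vec TYPE(complex) n)"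
  obtains k U where "isometry n k U" "\<And>x. x \<in> carrier_vec k \<Longrightarrow> U *\<^sub>v x \<in> W"
    "\<And>w. w \<in> W \<Longrightarrow> U *\<^sub>v (mat_adjoint U *\<^sub>v w) = w"
proof -
  note D = subspace_vecD[OF W]
  define P where "P k \<longleftrightarrow> (\<exists>U. isometry n k U \<and> (\<forall>x\<in>carrier_vec k. U *\<^sub>v x \<in> W))" for k
  have "isometry n 0 (0\<^sub>m n 0)"
    unfolding isometry_def by (auto intro!: eq_matI)
  moreover have "0\<^sub>m n 0 *\<^sub>v x = 0\<^sub>v n" if "x \<in> carrier_vec 0" for x :: "complex vec"
    using that by (intro eq_vecI) (auto simp: scalar_prod_def)
  ultimately have P0: "P 0" unfolding P_def using D(2) by metis
  have bound: "k \<le> n" if "P k" for k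
    using that isometry_dim_le unfolding P_def isometry_def by blast
  define k where "k = (GREATEST k. P k)"
  have "P k" unfolding k_def using GreatestI_nat[of P 0 n] P0 bound by blast
  then obtain U where U: "isometry n k U" and UW: "\<And>x. x \<in> carrier_vec k \<Longrightarrow> U *\<^sub>v x \<in> W"
    unfolding P_def by blast
  have not_more: "\<not> P (Suc k)"
    using Greatest_le_nat[of P "Suc k" n] bound unfolding k_def by fastforce
  have Uc: "U \<in> carrier_mat n k" and UU: "mat_adjoint U * U = 1\<^sub>m k" using U by (auto simp: isometry_def)
  have "U *\<^sub>v (mat_adjoint U *\<^sub>v w) = w" if w: "w \<in> W" for w
  proof (rule ccontr)
    assume ne: "U *\<^sub>v (mat_adjoint U *\<^sub>v w) \<noteq> w"
    have wc: "w \<in> carrier_vec n" using D(1) w by blast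
    define y where "y = mat_adjoint U *\<^sub>v w"
    have y: "y \<in> carrier_vec k" unfolding y_def by (rule mult_mat_vec_carrier_dim) (use Uc in auto)
    define d where "d = w + (-1) \<cdot>\<^sub>v (U *\<^sub>v y)"
    have Uy: "U *\<^sub>v y \<in> carrier_vec n" using Uc y by simp
    have dW: "d \<in> W" unfolding d_def by (rule D(3)[OF w D(4)[OF UW[OF y]]])
    have dc: "d \<in> carrier_vec n" using dW D(1) by blast
    have "d \<noteq> 0\<^sub>v n"
    proof
      assume d0: "d = 0\<^sub>v n"
      have "U *\<^sub>v y = w"
      proof (rule eq_vecI)
        fix i assume i: "i < dim_vec w"
        have "d $ i = w $ i - (U *\<^sub>v y) $ i" using i wc Uy Uc unfolding d_def by auto
        then show "(U *\<^sub>v y) $ i = w $ i" using d0 i wc by simp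
      qed (use Uc wc in auto)
      then show False using ne by (simp add: y_def)
    qed
    moreover have "mat_adjoint U *\<^sub>v d = 0\<^sub>v k"
    proof -
      have "mat_adjoint U *\<^sub>v d = mat_adjoint U *\<^sub>v w + mat_adjoint U *\<^sub>v ((-1) \<cdot>\<^sub>v (U *\<^sub>v y))"
        unfolding d_def using Uc wc Uy by (intro mult_add_distrib_mat_vec[of _ k n]) auto
      also have "mat_adjoint U *\<^sub>v ((-1) \<cdot>\<^sub>v (U *\<^sub>v y)) = (-1) \<cdot>\<^sub>v (mat_adjoint U *\<^sub>v (U *\<^sub>v y))"
        using Uc Uy by (intro mult_mat_vec[of _ k n]) auto
      also have "mat_adjoint U *\<^sub>v (U *\<^sub>v y) = y" by (rule isometry_image_inj[OF Uc UU y])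
      finally show ?thesis using y unfolding y_def[symmetric] by (intro eq_vecI) auto
    qed
    ultimately obtain V c where V: "isometry n (Suc k) V"
      and Vx: "\<And>x. x \<in> carrier_vec (Suc k) \<Longrightarrow> V *\<^sub>v x = U *\<^sub>v vec k (\<lambda>i. x $ i) + (c * x $ k) \<cdot>\<^sub>v d"
      using isometry_extend[OF U dc] by blast
    have "V *\<^sub>v x \<in> W" if "x \<in> carrier_vec (Suc k)" for x
      unfolding Vx[OF that] by (intro D UW dW) auto
    then show False using not_more V unfolding P_def by blast
  qed
  then show thesis using that U UW by blast
qed

text \<open>
  The data of an orthogonal decomposition into two proper summands of dimensions \<open>k\<close> and \<open>m\<close>,
  given by orthonormal bases of the summands.
\<close>

definition orthogonal_splitting :: "nat \<Rightarrow> nat \<Rightarrow> nat \<Rightarrow> complex mat \<Rightarrow> complex mat \<Rightarrow> bool" where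
  "orthogonal_splitting n k m U V \<longleftrightarrow> k \<in> {1..<n} \<and> m \<in> {1..<n} \<and> isometry n k U \<and> isometry n m V \<and>
    U * mat_adjoint U + V * mat_adjoint V = 1\<^sub>m n"

text \<open>
  \<open>U * mat_adjoint U\<close> is the orthogonal projection onto the range of an isometry \<open>U\<close>. That \<open>A\<close>
  commutes with it says that both this range and its orthogonal complement are invariant under \<open>A\<close>.
\<close>

definition reduces :: "complex mat \<Rightarrow> complex mat \<Rightarrow> bool" where
  "reduces U A \<longleftrightarrow> A * (U * mat_adjoint U) = U * mat_adjoint U * A"

text \<open>
  Orthonormal bases of \<open>W\<close> and of its orthogonal complement give the splitting. With the projection
  \<open>P\<close> onto \<open>W\<close>, invariance of \<open>W\<close> under \<open>A\<close> reads \<open>P A P = A P\<close>; invariance under the adjoint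
  reads \<open>P A P = P A\<close> after taking adjoints. Both together make \<open>A\<close> commute with \<open>P\<close>.
\<close>

lemma orthogonal_splitting_subspace:
  assumes W: "VectorSpace.subspace class_ring W (module_vec TYPE(complex) n)"
    and W0: "W \<noteq> {0\<^sub>v n}" and Wn: "W \<noteq> carrier_vec n"
  obtains k m U V where "orthogonal_splitting n k m U V"
    "\<And>A. A \<in> carrier_mat n n \<Longrightarrow> (\<And>w. w \<in> W \<Longrightarrow> A *\<^sub>v w \<in> W) \<Longrightarrow> (\<And>w. w \<in> W \<Longrightarrow> mat_adjoint A *\<^sub>v w \<in> W)
      \<Longrightarrow> reduces U A"
proof -
  note D = subspace_vecD[OF W]
  obtain k U where U: "isometry n k U" and UW: "\<And>x. x \<in> carrier_vec k \<Longrightarrow> U *\<^sub>v x \<in> W"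
    and Uw: "\<And>w. w \<in> W \<Longrightarrow> U *\<^sub>v (mat_adjoint U *\<^sub>v w) = w"
    using subspace_isometry[OF W] by blast
  have Uc [simp]: "U \<in> carrier_mat n k" and UU: "mat_adjoint U * U = 1\<^sub>m k" using U by (auto simp: isometry_def)
  have Ud [simp]: "dim_row U = n" "dim_col U = k" using Uc by blast+
  define W' where "W' = {v \<in> carrier_vec n. mat_adjoint U *\<^sub>v v = 0\<^sub>v k}"
  have W': "VectorSpace.subspace class_ring W' (module_vec TYPE(complex) n)"
  proof (rule subspace_vecI)
    fix v w assume "v \<in> W'" "w \<in> W'"
    then show "v + w \<in> W'"
      using mult_add_distrib_mat_vec[of "mat_adjoint U" k n v w] unfolding W'_def by simp
  next
    fix v c assume "v \<in> W'"
    then show "c \<cdot>\<^sub>v v \<in> W'"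
      using mult_mat_vec[of "mat_adjoint U" k n v c] unfolding W'_def by auto
  qed (auto simp: W'_def intro!: eq_vecI)
  obtain m V where V: "isometry n m V" and VW: "\<And>x. x \<in> carrier_vec m \<Longrightarrow> V *\<^sub>v x \<in> W'"
    and Vw: "\<And>w. w \<in> W' \<Longrightarrow> V *\<^sub>v (mat_adjoint V *\<^sub>v w) = w"
    using subspace_isometry[OF W'] by blast
  have Vc [simp]: "V \<in> carrier_mat n m" and VV: "mat_adjoint V * V = 1\<^sub>m m" using V by (auto simp: isometry_def)
  have Vd [simp]: "dim_row V = n" "dim_col V = m" using Vc by blast+
  have UV: "mat_adjoint U * V = 0\<^sub>m k m"
  proof (rule mat_eq_by_vectors[of _ k m])
    fix x :: "complex vec" assume x: "x \<in> carrier_vec m"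
    then have "mat_adjoint U *\<^sub>v (V *\<^sub>v x) = 0\<^sub>v k" using VW unfolding W'_def by blast
    then show "mat_adjoint U * V *\<^sub>v x = 0\<^sub>m k m *\<^sub>v x" using x by (auto simp: mat_vec_assoc)
  qed (auto intro: mult_carrier_mat[of _ k n])
  have VU: "mat_adjoint V * U = 0\<^sub>m m k"
  proof -
    have "mat_adjoint (mat_adjoint U * V) = mat_adjoint V * U" by (simp add: mat_adjoint_mult)
    moreover have "mat_adjoint (0\<^sub>m k m :: complex mat) = 0\<^sub>m m k" by (rule eq_matI) auto
    ultimately show ?thesis using UV by simp
  qed
  have sum1: "U * mat_adjoint U + V * mat_adjoint V = 1\<^sub>m n"
  proof (rule mat_eq_by_vectors[of _ n n])
    fix x :: "complex vec" assume x: "x \<in> carrier_vec n"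
    define y where "y = U *\<^sub>v (mat_adjoint U *\<^sub>v x)"
    have y: "y \<in> carrier_vec n" unfolding y_def by (rule mult_mat_vec_carrier_dim) simp
    have Uy: "mat_adjoint U *\<^sub>v y = mat_adjoint U *\<^sub>v x"
      unfolding y_def by (rule isometry_image_inj[OF Uc UU]) (rule mult_mat_vec_carrier_dim, simp)
    have Ux: "mat_adjoint U *\<^sub>v x \<in> carrier_vec k" by (rule mult_mat_vec_carrier_dim) simp
    have "mat_adjoint U *\<^sub>v (x - y) = 0\<^sub>v k"
      using mult_minus_distrib_mat_vec[of "mat_adjoint U" k n x y] x y Uy Ux by simp
    then have W'xy: "x - y \<in> W'" unfolding W'_def using x y by simp
    have Vy: "mat_adjoint V *\<^sub>v y = 0\<^sub>v m"
    proof -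
      have "mat_adjoint V *\<^sub>v y = mat_adjoint V * U *\<^sub>v (mat_adjoint U *\<^sub>v x)"
        unfolding y_def by (rule mat_vec_assoc[symmetric]) auto
      then show ?thesis unfolding VU using Ux by (auto intro!: eq_vecI)
    qed
    have Vx: "mat_adjoint V *\<^sub>v x \<in> carrier_vec m" by (rule mult_mat_vec_carrier_dim) simp
    have "mat_adjoint V *\<^sub>v (x - y) = mat_adjoint V *\<^sub>v x"
      using mult_minus_distrib_mat_vec[of "mat_adjoint V" m n x y] x y Vy Vx by simp
    then have "V *\<^sub>v (mat_adjoint V *\<^sub>v x) = x - y" using Vw[OF W'xy] by simp
    moreover have "(U * mat_adjoint U + V * mat_adjoint V) *\<^sub>v x = y + V *\<^sub>v (mat_adjoint V *\<^sub>v x)"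
      unfolding y_def using x
      by (subst add_mult_distrib_mat_vec[of _ n n])
        (auto simp: mat_vec_assoc intro: mult_carrier_mat[of _ n k] mult_carrier_mat[of _ n m])
    ultimately show "(U * mat_adjoint U + V * mat_adjoint V) *\<^sub>v x = 1\<^sub>m n *\<^sub>v x"
      using x y by auto
  qed auto
  have W_all: False if "U * mat_adjoint U = 1\<^sub>m n"
  proof -
    have "v \<in> W" if v: "v \<in> carrier_vec n" for v
    proof -
      have "U *\<^sub>v (mat_adjoint U *\<^sub>v v) = v"
        using mat_vec_assoc[of U "mat_adjoint U" v] \<open>U * mat_adjoint U = 1\<^sub>m n\<close> v by simp
      moreover have "mat_adjoint U *\<^sub>v v \<in> carrier_vec k"
        by (rule mult_mat_vec_carrier_dim) simp
      ultimately show ?thesis using UW by metis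
    qed
    then show False using Wn D(1) by blast
  qed
  have W_zero: False if "\<And>w. w \<in> W \<Longrightarrow> U *\<^sub>v (mat_adjoint U *\<^sub>v w) = 0\<^sub>v n"
    using that Uw W0 D(2) by fastforce
  have k1: "k \<noteq> 0"
  proof
    assume k: "k = 0"
    show False
      by (rule W_zero) (use D(1) k in \<open>auto simp: scalar_prod_def intro!: eq_vecI\<close>)
  qed
  have m1: "m \<noteq> 0"
  proof
    assume "m = 0"
    then have "V * mat_adjoint V = 0\<^sub>m n n" by (auto simp: scalar_prod_def intro!: eq_matI)
    then show False using sum1 W_all right_add_zero_mat[of "U * mat_adjoint U" n n]
      by (simp add: mult_carrier_mat[of U n k])
  qed
  have kn: "k < n"
  proof -
    have "k \<noteq> n"
    proof
      assume "k = n"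
      then have "U * mat_adjoint U = 1\<^sub>m n"
        using UU by (intro mat_mult_left_right_inverse[of "mat_adjoint U" n U]) auto
      then show False by (rule W_all)
    qed
    then show ?thesis using isometry_dim_le[OF Uc UU] by simp
  qed
  have mn: "m < n"
  proof -
    have "m \<noteq> n"
    proof
      assume m: "m = n"
      then have "V * mat_adjoint V = 1\<^sub>m n"
        using VV by (intro mat_mult_left_right_inverse[of "mat_adjoint V" n V]) auto
      then have "mat_adjoint U * (V * mat_adjoint V) = mat_adjoint U" using right_mult_one_mat[of "mat_adjoint U" k n] by simp
      then have "mat_adjoint U = 0\<^sub>m k n"
        using mat_cancel_left[OF UV, of "mat_adjoint V"] by (simp add: m)
      then have "1\<^sub>m k = 0\<^sub>m k n * U" using UU by simp
      also have "\<dots> = 0\<^sub>m k k" by simp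
      finally have "(1\<^sub>m k :: complex mat) $$ (0, 0) = 0\<^sub>m k k $$ (0, 0)" by simp
      then show False using k1 by simp
    qed
    then show ?thesis using isometry_dim_le[OF Vc VV] by simp
  qed
  have "reduces U A"
    if A: "A \<in> carrier_mat n n" and AW: "\<And>w. w \<in> W \<Longrightarrow> A *\<^sub>v w \<in> W"
      and AW': "\<And>w. w \<in> W \<Longrightarrow> mat_adjoint A *\<^sub>v w \<in> W" for A
  proof -
    define P where "P = U * mat_adjoint U"
    have Pc: "P \<in> carrier_mat n n" unfolding P_def by (rule mult_carrier_mat[of _ n k]) auto
    have dims: "dim_row P = n" "dim_col P = n" "dim_row A = n" "dim_col A = n" using Pc A by auto
    have PP: "mat_adjoint P = P" unfolding P_def by (simp add: mat_adjoint_mult)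
    have *: "P * (B * P) = B * P" if B: "B \<in> carrier_mat n n" and BW: "\<And>w. w \<in> W \<Longrightarrow> B *\<^sub>v w \<in> W" for B
    proof (rule mat_eq_by_vectors[of _ n n])
      fix x :: "complex vec" assume x: "x \<in> carrier_vec n"
      have "P *\<^sub>v x \<in> W"
        unfolding P_def using x by (subst mat_vec_assoc) (auto intro!: UW mult_mat_vec_carrier_dim)
      then have BPx: "B *\<^sub>v (P *\<^sub>v x) \<in> W" by (rule BW)
      then have "P *\<^sub>v (B *\<^sub>v (P *\<^sub>v x)) = B *\<^sub>v (P *\<^sub>v x)"
        using Uw[OF BPx] D(1) B unfolding P_def by (subst mat_vec_assoc) auto
      then show "P * (B * P) *\<^sub>v x = B * P *\<^sub>v x" using x B Pc dims by (auto simp: mat_vec_assoc)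
    qed (use B Pc in auto)
    have 1: "P * (A * P) = A * P" by (rule *[OF A AW])
    have "P * (mat_adjoint A * P) = mat_adjoint A * P" by (rule *[OF mat_adjoint_carrier[OF A] AW'])
    then have "mat_adjoint (P * (mat_adjoint A * P)) = mat_adjoint (mat_adjoint A * P)" by simp
    then have "P * A * P = P * A" using dims by (simp add: mat_adjoint_mult PP)
    then have "A * P = P * A" using 1 dims by (simp add: mat_assoc)
    then show ?thesis unfolding reduces_def P_def .
  qed
  moreover have "orthogonal_splitting n k m U V"
    using k1 m1 kn mn U V sum1 by (auto simp: orthogonal_splitting_def)
  ultimately show thesis using that by blast
qed

section \<open>Restricting to an invariant subspace\<close>

text \<open>
  If the range of \<open>U\<close> is invariant under \<open>A\<close>, this is the matrix of the restriction of \<open>A\<close> to it, in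
  the orthonormal basis given by the columns of \<open>U\<close>. Without invariance it need not be multiplicative.
\<close>

definition compress :: "complex mat \<Rightarrow> complex mat \<Rightarrow> complex mat" where
  "compress U A = mat_adjoint U * (A * U)"

lemma compress_carrier: "isometry n k U \<Longrightarrow> compress U A \<in> carrier_mat k k"
  unfolding compress_def isometry_def by (intro carrier_matI) auto

lemma compress_one: "isometry n k U \<Longrightarrow> compress U (1\<^sub>m n) = 1\<^sub>m k"
  unfolding compress_def isometry_def by auto

lemma compress_adjoint:
  assumes "isometry n k U" "A \<in> carrier_mat n n"
  shows "compress U (mat_adjoint A) = mat_adjoint (compress U A)"
proof -
  have "dim_row U = n" "dim_row A = n" "dim_col A = n" using assms by (auto simp: isometry_def)
  then show ?thesis unfolding compress_def by (simp add: mat_adjoint_mult mat_assoc)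
qed

lemma reduces_intertwine:
  assumes U: "isometry n k U" and A: "A \<in> carrier_mat n n" and r: "reduces U A"
  shows "A * U = U * compress U A"
proof -
  have d: "dim_row U = n" "dim_col U = k" "dim_row A = n" "dim_col A = n"
    and UU: "mat_adjoint U * U = 1\<^sub>m k" and Uc: "U \<in> carrier_mat n k" using U A by (auto simp: isometry_def)
  have "A * U = A * (U * (mat_adjoint U * U))" unfolding UU using right_mult_one_mat[OF Uc] by simp
  also have "\<dots> = A * (U * mat_adjoint U) * U" using d by (simp add: mat_assoc)
  also have "\<dots> = U * mat_adjoint U * A * U" using r unfolding reduces_def by simp
  also have "\<dots> = U * compress U A" unfolding compress_def using d by (simp add: mat_assoc)
  finally show ?thesis .
qed

lemma compress_mult:
  assumes U: "isometry n k U" and A: "A \<in> carrier_mat n n" and B: "B \<in> carrier_mat n n" and r: "reduces U B"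
  shows "compress U (A * B) = compress U A * compress U B"
proof -
  have d: "dim_row U = n" "dim_col U = k" "dim_row A = n" "dim_col A = n" "dim_row B = n" "dim_col B = n"
    using U A B by (auto simp: isometry_def)
  have dc: "dim_row (compress U B) = k" using compress_carrier[OF U] by blast
  have "compress U (A * B) = mat_adjoint U * (A * (B * U))"
    unfolding compress_def using d by (simp add: mat_assoc)
  also have "\<dots> = mat_adjoint U * (A * (U * compress U B))" unfolding reduces_intertwine[OF U B r] ..
  also have "\<dots> = compress U A * compress U B"
    using d dc unfolding compress_def[of U A] by (simp add: mat_assoc)
  finally show ?thesis .
qed

text \<open>
  The two projections of a splitting add up to the identity, so what commutes with one commutes with
  the other.
\<close>

lemma splitting_reduces_complement:
  assumes s: "orthogonal_splitting n k m U V" and A: "A \<in> carrier_mat n n" and r: "reduces U A"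
  shows "reduces V A"
proof -
  define P where "P = U * mat_adjoint U"
  define Q where "Q = V * mat_adjoint V"
  have P: "P \<in> carrier_mat n n" and Q: "Q \<in> carrier_mat n n" and PQ: "P + Q = 1\<^sub>m n"
    using s unfolding P_def Q_def orthogonal_splitting_def isometry_def
    by (auto intro!: carrier_matI)
  have "A * P + A * Q = P * A + Q * A"
    using mult_add_distrib_mat[OF A P Q] add_mult_distrib_mat[OF P Q A] PQ A by simp
  moreover have "A * P = P * A" using r unfolding reduces_def P_def .
  ultimately have eq: "P * A + A * Q = P * A + Q * A" by simp
  have "A * Q = Q * A"
  proof (rule eq_matI)
    fix i j assume "i < dim_row (Q * A)" "j < dim_col (Q * A)"
    then have ij: "i < n" "j < n" using Q A by auto
    have "(P * A + A * Q) $$ (i, j) = (P * A + Q * A) $$ (i, j)" using eq by simp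
    moreover have "(P * A + A * Q) $$ (i, j) = (P * A) $$ (i, j) + (A * Q) $$ (i, j)"
      by (rule index_add_mat(1)) (use ij A Q in auto)
    moreover have "(P * A + Q * A) $$ (i, j) = (P * A) $$ (i, j) + (Q * A) $$ (i, j)"
      by (rule index_add_mat(1)) (use ij A Q in auto)
    ultimately show "(A * Q) $$ (i, j) = (Q * A) $$ (i, j)" by simp
  qed (use A Q in auto)
  then show ?thesis unfolding reduces_def Q_def .
qed

text \<open>
  Block diagonal matrices with equal blocks are equal: \<open>A\<close> is recovered from its blocks by
  \<open>A = U * compress U A * mat_adjoint U + V * compress V A * mat_adjoint V\<close>.
\<close>

lemma splitting_determines:
  assumes s: "orthogonal_splitting n k m U V" and A: "A \<in> carrier_mat n n" and B: "B \<in> carrier_mat n n"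
    and rA: "reduces U A" and rB: "reduces U B"
    and eqU: "compress U A = compress U B" and eqV: "compress V A = compress V B"
  shows "A = B"
proof -
  have U: "isometry n k U" and V: "isometry n m V"
    and sum1: "U * mat_adjoint U + V * mat_adjoint V = 1\<^sub>m n"
    using s by (auto simp: orthogonal_splitting_def)
  have c: "U * mat_adjoint U \<in> carrier_mat n n" "V * mat_adjoint V \<in> carrier_mat n n"
    using U V by (auto simp: isometry_def intro!: carrier_matI)
  have *: "C = U * compress U C * mat_adjoint U + V * compress V C * mat_adjoint V"
    if C: "C \<in> carrier_mat n n" and r: "reduces U C" for C
  proof -
    have "C = C * (U * mat_adjoint U + V * mat_adjoint V)" unfolding sum1 using C by simp
    also have "\<dots> = C * (U * mat_adjoint U) + C * (V * mat_adjoint V)"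
      by (rule mult_add_distrib_mat[OF C c])
    also have "C * (U * mat_adjoint U) = C * U * mat_adjoint U"
      by (rule mat_assoc[symmetric]) (use U C in \<open>auto simp: isometry_def\<close>)
    also have "C * (V * mat_adjoint V) = C * V * mat_adjoint V"
      by (rule mat_assoc[symmetric]) (use V C in \<open>auto simp: isometry_def\<close>)
    also have "C * U = U * compress U C" by (rule reduces_intertwine[OF U C r])
    also have "C * V = V * compress V C"
      by (rule reduces_intertwine[OF V C splitting_reduces_complement[OF s C r]])
    finally show ?thesis .
  qed
  show ?thesis using *[OF A rA] *[OF B rB] eqU eqV by simp
qed

lemma unitary_rep_compress:
  assumes G: "group G" and rep: "unitary_rep G n \<pi>" and U: "isometry n k U" and k: "1 \<le> k"
    and r: "\<And>g. g \<in> carrier G \<Longrightarrow> reduces U (\<pi> g)"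
  shows "unitary_rep G k (\<lambda>g. compress U (\<pi> g))"
proof (rule unitary_repI[OF G k])
  note D = unitary_repD[OF G rep]
  show "compress U (\<pi> g) \<in> carrier_mat k k" for g by (rule compress_carrier[OF U])
  show "compress U (\<pi> (g \<otimes>\<^bsub>G\<^esub> h)) = compress U (\<pi> g) * compress U (\<pi> h)"
    if "g \<in> carrier G" "h \<in> carrier G" for g h
    using that by (simp add: D(3) compress_mult[OF U D(2) D(2) r])
  show "compress U (\<pi> \<one>\<^bsub>G\<^esub>) = 1\<^sub>m k" by (simp add: D(4) compress_one[OF U])
  show "compress U (\<pi> (inv\<^bsub>G\<^esub> g)) = mat_adjoint (compress U (\<pi> g))" if "g \<in> carrier G" for g
    using that by (simp add: D(5) compress_adjoint[OF U D(2)])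
qed

text \<open>
  Complete reducibility, in the form needed for separating points: if \<open>\<pi>\<close> is not irreducible, an
  invariant subspace and its orthogonal complement carry representations of smaller dimension, and
  \<open>g\<close> cannot act trivially on both. Restricting to a subspace keeps the image finite.
\<close>

lemma irreducible_constituent:
  assumes G: "group G" and g: "g \<in> carrier G"
  shows "unitary_rep G n \<pi> \<Longrightarrow> \<pi> g \<noteq> 1\<^sub>m n \<Longrightarrow>
    \<exists>k \<rho>. irreducible_unitary_rep G k \<rho> \<and> \<rho> g \<noteq> 1\<^sub>m k \<and>
      (finite (\<pi> ` carrier G) \<longrightarrow> finite (\<rho> ` carrier G))"
proof (induction n arbitrary: \<pi> rule: less_induct)
  case (less n)
  note D = unitary_repD[OF G less.prems(1)]
  show ?case
  proof (cases "irreducible_unitary_rep G n \<pi>")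
    case True
    then show ?thesis using less.prems by blast
  next
    case False
    then obtain W where W: "VectorSpace.subspace class_ring W (module_vec TYPE(complex) n)"
      and inv: "\<And>h w. h \<in> carrier G \<Longrightarrow> w \<in> W \<Longrightarrow> \<pi> h *\<^sub>v w \<in> W"
      and ne: "W \<noteq> {0\<^sub>v n}" "W \<noteq> carrier_vec n"
      using less.prems(1) unfolding irreducible_unitary_rep_def invariant_subspace_def by blast
    obtain k m U V where s: "orthogonal_splitting n k m U V"
      and rU: "\<And>A. A \<in> carrier_mat n n \<Longrightarrow> (\<And>w. w \<in> W \<Longrightarrow> A *\<^sub>v w \<in> W) \<Longrightarrow>
        (\<And>w. w \<in> W \<Longrightarrow> mat_adjoint A *\<^sub>v w \<in> W) \<Longrightarrow> reduces U A"
      using orthogonal_splitting_subspace[OF W ne] by blast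
    have r: "reduces U (\<pi> h)" if h: "h \<in> carrier G" for h
    proof (rule rU)
      show "\<pi> h \<in> carrier_mat n n" by (rule D(2)[OF h])
      show "\<And>w. w \<in> W \<Longrightarrow> \<pi> h *\<^sub>v w \<in> W" by (rule inv[OF h])
      have "inv\<^bsub>G\<^esub> h \<in> carrier G" using G h by (rule group.inv_closed)
      then show "\<And>w. w \<in> W \<Longrightarrow> mat_adjoint (\<pi> h) *\<^sub>v w \<in> W" using inv D(5)[OF h] by metis
    qed
    have rV: "reduces V (\<pi> h)" if "h \<in> carrier G" for h
      by (rule splitting_reduces_complement[OF s D(2)[OF that] r[OF that]])
    have dims: "isometry n k U" "isometry n m V" "1 \<le> k" "k < n" "1 \<le> m" "m < n"
      using s by (auto simp: orthogonal_splitting_def)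
    have fin: "finite (\<pi> ` carrier G) \<Longrightarrow> finite ((\<lambda>h. compress X (\<pi> h)) ` carrier G)" for X
      using finite_imageI[of "\<pi> ` carrier G" "compress X"] by (simp add: image_image)
    have "compress U (\<pi> g) \<noteq> 1\<^sub>m k \<or> compress V (\<pi> g) \<noteq> 1\<^sub>m m"
    proof (rule ccontr)
      assume "\<not> ?thesis"
      then have "compress U (\<pi> g) = compress U (1\<^sub>m n)" "compress V (\<pi> g) = compress V (1\<^sub>m n)"
        using compress_one dims by auto
      moreover have "reduces U (1\<^sub>m n)"
        using r[of "\<one>\<^bsub>G\<^esub>"] D(4) G by (simp add: group.is_monoid)
      ultimately have "\<pi> g = 1\<^sub>m n"
        by (intro splitting_determines[OF s D(2)[OF g] one_carrier_mat r[OF g]])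
      then show False using less.prems(2) by simp
    qed
    then show ?thesis
      using less.IH[OF \<open>k < n\<close> unitary_rep_compress[OF G less.prems(1) dims(1,3) r]]
        less.IH[OF \<open>m < n\<close> unitary_rep_compress[OF G less.prems(1) dims(2,5) rV]] fin
      by blast
  qed
qed

text \<open>
  The two properties of the theorem in one: the flag says whether finite images are required. It allows
  the two parts to be proved together, and no irreducibility has to be preserved by constructions.
\<close>

definition unitarily_separated :: "bool \<Rightarrow> ('a, 'b) monoid_scheme \<Rightarrow> bool" where
  "unitarily_separated fin G \<longleftrightarrow>
    (\<forall>g\<in>carrier G. g \<noteq> \<one>\<^bsub>G\<^esub> \<longrightarrow>
      (\<exists>n \<pi>. unitary_rep G n \<pi> \<and> (fin \<longrightarrow> finite (\<pi> ` carrier G)) \<and> \<pi> g \<noteq> 1\<^sub>m n))"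

lemma separates_points_iff:
  assumes G: "group G"
  shows "(\<forall>x\<in>carrier G. \<forall>y\<in>carrier G. x \<noteq> y \<longrightarrow>
      (\<exists>n \<pi>. irreducible_unitary_rep G n \<pi> \<and> (fin \<longrightarrow> finite (\<pi> ` carrier G)) \<and> \<pi> x \<noteq> \<pi> y)) \<longleftrightarrow>
    unitarily_separated fin G" (is "?lhs \<longleftrightarrow> ?rhs")
proof
  interpret group G by fact
  assume L: ?lhs
  show ?rhs
    unfolding unitarily_separated_def
  proof (intro ballI impI)
    fix g assume g: "g \<in> carrier G" "g \<noteq> \<one>\<^bsub>G\<^esub>"
    then obtain n \<pi> where \<pi>: "irreducible_unitary_rep G n \<pi>" "fin \<longrightarrow> finite (\<pi> ` carrier G)" "\<pi> g \<noteq> \<pi> \<one>\<^bsub>G\<^esub>"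
      using L by blast
    then have "unitary_rep G n \<pi>" by (simp add: irreducible_unitary_rep_def)
    with \<pi> show "\<exists>n \<pi>. unitary_rep G n \<pi> \<and> (fin \<longrightarrow> finite (\<pi> ` carrier G)) \<and> \<pi> g \<noteq> 1\<^sub>m n"
      using unitary_repD(4)[OF G] by metis
  qed
next
  interpret group G by fact
  assume R: ?rhs
  show ?lhs
  proof (intro ballI impI)
    fix x y assume xy: "x \<in> carrier G" "y \<in> carrier G" "x \<noteq> y"
    define g where "g = inv\<^bsub>G\<^esub> x \<otimes>\<^bsub>G\<^esub> y"
    have g: "g \<in> carrier G" "g \<noteq> \<one>\<^bsub>G\<^esub>"
      using xy inv_solve_left[of "\<one>\<^bsub>G\<^esub>" x y] by (auto simp: g_def)
    then obtain n \<pi> where "unitary_rep G n \<pi>" "fin \<longrightarrow> finite (\<pi> ` carrier G)" "\<pi> g \<noteq> 1\<^sub>m n"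
      using R unfolding unitarily_separated_def by blast
    then obtain k \<rho> where \<rho>: "irreducible_unitary_rep G k \<rho>" "fin \<longrightarrow> finite (\<rho> ` carrier G)" "\<rho> g \<noteq> 1\<^sub>m k"
      using irreducible_constituent[OF G g(1)] by blast
    then have rep: "unitary_rep G k \<rho>" by (simp add: irreducible_unitary_rep_def)
    note D = unitary_repD[OF G rep]
    have "\<rho> x \<noteq> \<rho> y"
    proof
      assume "\<rho> x = \<rho> y"
      then have "\<rho> g = 1\<^sub>m k" unfolding g_def using xy D(7)[of x] by (simp add: D(3,5))
      then show False using \<rho>(3) by simp
    qed
    then show "\<exists>n \<pi>. irreducible_unitary_rep G n \<pi> \<and> (fin \<longrightarrow> finite (\<pi> ` carrier G)) \<and> \<pi> x \<noteq> \<pi> y"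
      using \<rho> by blast
  qed
qed

lemma maximally_almost_periodic_iff: "group G \<Longrightarrow> maximally_almost_periodic G \<longleftrightarrow> unitarily_separated False G"
  using separates_points_iff[of G False] by (simp add: maximally_almost_periodic_def)

lemma residually_finite_iff: "group G \<Longrightarrow> residually_finite G \<longleftrightarrow> unitarily_separated True G"
  using separates_points_iff[of G True] by (simp add: residually_finite_def)

section \<open>Commuting unitary matrices with a common finite spectrum\<close>

lemma spectrum_iff:
  "A \<in> carrier_mat n n \<Longrightarrow> c \<in> spectrum A \<longleftrightarrow> (\<exists>v\<in>carrier_vec n. v \<noteq> 0\<^sub>v n \<and> A *\<^sub>v v = c \<cdot>\<^sub>v v)"
  by (auto simp: spectrum_def eigenvalue_def eigenvector_def)

text \<open>
  Simultaneous diagonalisation, as an induction on the dimension. Scalar matrices are determined by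
  their eigenvalue. If some \<open>A\<close> in \<open>S\<close> is not scalar, an eigenspace of \<open>A\<close> is invariant under all
  matrices commuting with \<open>A\<close>, so the whole family splits into two blocks of smaller dimension. Each
  family of blocks is again commuting, unitary and with eigenvalues in \<open>E\<close>, hence finite, and a
  matrix is determined by its two blocks.
\<close>

lemma finite_commuting_unitaries:
  assumes E: "finite E"
  shows "S \<subseteq> carrier (unitary_group n) \<Longrightarrow> (\<And>A B. A \<in> S \<Longrightarrow> B \<in> S \<Longrightarrow> A * B = B * A) \<Longrightarrow>
    (\<And>A. A \<in> S \<Longrightarrow> spectrum A \<subseteq> E) \<Longrightarrow> finite S"
proof (induction n arbitrary: S rule: less_induct)
  case (less n)
  have c: "A \<in> carrier_mat n n" and u: "A * mat_adjoint A = 1\<^sub>m n" "mat_adjoint A * A = 1\<^sub>m n"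
    if "A \<in> S" for A
    using that less.prems(1) by (auto simp: unitary_group_simps)
  show ?case
  proof (cases "\<forall>A\<in>S. \<exists>c. A = c \<cdot>\<^sub>m 1\<^sub>m n")
    case True
    \<comment> \<open>A scalar matrix of size \<open>0\<close> has no eigenvalue; the scalar \<open>0\<close> covers this case.\<close>
    have "S \<subseteq> (\<lambda>c. c \<cdot>\<^sub>m 1\<^sub>m n) ` insert 0 E"
    proof
      fix A assume A: "A \<in> S"
      then obtain c where Ac: "A = c \<cdot>\<^sub>m 1\<^sub>m n" using True by blast
      show "A \<in> (\<lambda>c. c \<cdot>\<^sub>m 1\<^sub>m n) ` insert 0 E"
      proof (cases "n = 0")
        case True
        then have "A = 0 \<cdot>\<^sub>m 1\<^sub>m n" unfolding Ac by (intro eq_matI) auto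
        then show ?thesis by blast
      next
        case False
        have "A *\<^sub>v unit_vec n 0 = c \<cdot>\<^sub>v unit_vec n 0"
          unfolding Ac using False by (intro eq_vecI) auto
        moreover have "unit_vec n 0 \<noteq> (0\<^sub>v n :: complex vec)"
        proof
          assume "unit_vec n 0 = (0\<^sub>v n :: complex vec)"
          then have "unit_vec n 0 $ 0 = (0\<^sub>v n :: complex vec) $ 0" by simp
          then show False using False by simp
        qed
        ultimately have "c \<in> spectrum A" using spectrum_iff[OF c[OF A]] unit_vec_carrier by blast
        then show ?thesis using less.prems(3)[OF A] Ac by blast
      qed
    qed
    then show ?thesis using E finite_subset by blast
  next
    case False
    then obtain A where A: "A \<in> S" and ns: "\<And>c. A \<noteq> c \<cdot>\<^sub>m 1\<^sub>m n" by blast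
    have "n \<noteq> 0"
    proof
      assume "n = 0"
      then have "A = 0 \<cdot>\<^sub>m 1\<^sub>m n" using c[OF A] by (intro eq_matI) auto
      then show False using ns by blast
    qed
    then obtain l where "l \<in> spectrum A" using spectrum_non_empty[OF c[OF A]] by blast
    then obtain v where v: "v \<in> carrier_vec n" "v \<noteq> 0\<^sub>v n" "A *\<^sub>v v = l \<cdot>\<^sub>v v"
      using spectrum_iff[OF c[OF A]] by blast
    define W where "W = {w \<in> carrier_vec n. A *\<^sub>v w = l \<cdot>\<^sub>v w}"
    have W: "VectorSpace.subspace class_ring W (module_vec TYPE(complex) n)"
    proof (rule subspace_vecI)
      fix x y assume "x \<in> W" "y \<in> W"
      then show "x + y \<in> W"
        using mult_add_distrib_mat_vec[OF c[OF A], of x y] smult_add_distrib_vec[of x n y l]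
        unfolding W_def by simp
    next
      fix x a assume "x \<in> W"
      then show "a \<cdot>\<^sub>v x \<in> W"
        using mult_mat_vec[OF c[OF A], of x a] unfolding W_def by (auto simp: smult_smult_assoc mult.commute)
    qed (use c[OF A] in \<open>auto simp: W_def intro!: eq_vecI\<close>)
    have "W \<noteq> {0\<^sub>v n}" using v unfolding W_def by blast
    moreover have "W \<noteq> carrier_vec n"
    proof
      assume Wn: "W = carrier_vec n"
      have "A = l \<cdot>\<^sub>m 1\<^sub>m n"
      proof (rule mat_eq_by_vectors[OF c[OF A]])
        fix x :: "complex vec" assume x: "x \<in> carrier_vec n"
        then have "A *\<^sub>v x = l \<cdot>\<^sub>v x" using Wn unfolding W_def by blast
        also have "\<dots> = l \<cdot>\<^sub>m 1\<^sub>m n *\<^sub>v x" using x by (intro eq_vecI) auto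
        finally show "A *\<^sub>v x = l \<cdot>\<^sub>m 1\<^sub>m n *\<^sub>v x" .
      qed auto
      then show False using ns by blast
    qed
    ultimately obtain k m U V where s: "orthogonal_splitting n k m U V"
      and rU: "\<And>A. A \<in> carrier_mat n n \<Longrightarrow> (\<And>w. w \<in> W \<Longrightarrow> A *\<^sub>v w \<in> W) \<Longrightarrow>
        (\<And>w. w \<in> W \<Longrightarrow> mat_adjoint A *\<^sub>v w \<in> W) \<Longrightarrow> reduces U A"
      using orthogonal_splitting_subspace[OF W] by blast
    have pres: "B *\<^sub>v w \<in> W" if B: "B \<in> carrier_mat n n" "A * B = B * A" and w: "w \<in> W" for B w
    proof -
      have wc: "w \<in> carrier_vec n" and Aw: "A *\<^sub>v w = l \<cdot>\<^sub>v w" using w by (auto simp: W_def)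
      have "A *\<^sub>v (B *\<^sub>v w) = B *\<^sub>v (A *\<^sub>v w)"
        using assoc_mult_mat_vec[OF c[OF A] B(1) wc] assoc_mult_mat_vec[OF B(1) c[OF A] wc] B(2) by simp
      also have "\<dots> = l \<cdot>\<^sub>v (B *\<^sub>v w)" unfolding Aw by (rule mult_mat_vec[OF B(1) wc])
      finally show ?thesis unfolding W_def using B(1) by (auto intro: mult_mat_vec_carrier_dim)
    qed
    \<comment> \<open>The orthogonal complement of the eigenspace is invariant as well, because the adjoint of a unitary
      matrix commutes with whatever the matrix itself commutes with.\<close>
    have adj_comm: "A * mat_adjoint B = mat_adjoint B * A" if B: "B \<in> S" for B
    proof -
      have d: "dim_row A = n" "dim_col A = n" "dim_row B = n" "dim_col B = n" using c[OF A] c[OF B] by auto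
      have "A * mat_adjoint B = mat_adjoint B * B * (A * mat_adjoint B)" 
        unfolding u(2)[OF B] by (rule left_mult_one_mat[symmetric], rule mult_carrier_mat[of _ n n]) (use c[OF A] c[OF B] in auto)
      also have "\<dots> = mat_adjoint B * (B * A) * mat_adjoint B" using d by (simp add: mat_assoc)
      also have "B * A = A * B" by (rule less.prems(2)[OF B A])
      also have "mat_adjoint B * (A * B) * mat_adjoint B = mat_adjoint B * (A * (B * mat_adjoint B))"
        using d by (simp add: mat_assoc)
      also have "\<dots> = mat_adjoint B * A" unfolding u(1)[OF B] using c[OF A] by simp
      finally show ?thesis .
    qed
    have r: "reduces U B" "reduces U (mat_adjoint B)" if B: "B \<in> S" for B
      by (rule rU; simp add: c[OF B] pres less.prems(2)[OF A B] adj_comm[OF B])+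
    have rV: "reduces V B" "reduces V (mat_adjoint B)" if B: "B \<in> S" for B
      using splitting_reduces_complement[OF s] r[OF B] c[OF B] by auto
    have dims: "isometry n k U" "isometry n m V" "k < n" "m < n"
      using s by (auto simp: orthogonal_splitting_def)
    have part: "finite (compress X ` S)"
      if X: "isometry n j X" and jn: "j < n" and rX: "\<And>B. B \<in> S \<Longrightarrow> reduces X B" "\<And>B. B \<in> S \<Longrightarrow> reduces X (mat_adjoint B)" for X j
    proof (rule less.IH[OF jn])
      note cm = compress_mult[OF X]
      show "compress X ` S \<subseteq> carrier (unitary_group j)"
        using c u rX by (auto simp: unitary_group_simps compress_carrier[OF X] compress_one[OF X]
            simp flip: compress_adjoint[OF X] cm)
      show "\<And>A B. A \<in> compress X ` S \<Longrightarrow> B \<in> compress X ` S \<Longrightarrow> A * B = B * A"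
        using c rX less.prems(2) by (auto simp flip: cm)
      fix A' assume "A' \<in> compress X ` S"
      then obtain B where B: "B \<in> S" and A': "A' = compress X B" by blast
      show "spectrum A' \<subseteq> E"
      proof
        fix a assume "a \<in> spectrum A'"
        then obtain x where x: "x \<in> carrier_vec j" "x \<noteq> 0\<^sub>v j" "compress X B *\<^sub>v x = a \<cdot>\<^sub>v x"
          using spectrum_iff[OF compress_carrier[OF X]] A' by blast
        have Xc: "X \<in> carrier_mat n j" and XX: "mat_adjoint X * X = 1\<^sub>m j" using X by (auto simp: isometry_def)
        have Xx: "X *\<^sub>v x \<in> carrier_vec n" by (rule mult_mat_vec_carrier_dim) (use Xc in auto)
        have "B *\<^sub>v (X *\<^sub>v x) = B * X *\<^sub>v x" by (rule assoc_mult_mat_vec[OF c[OF B] Xc x(1), symmetric])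
        also have "\<dots> = X *\<^sub>v (compress X B *\<^sub>v x)"
          unfolding reduces_intertwine[OF X c[OF B] rX(1)[OF B]]
          by (rule assoc_mult_mat_vec[OF Xc compress_carrier[OF X] x(1)])
        also have "\<dots> = a \<cdot>\<^sub>v (X *\<^sub>v x)" unfolding x(3) by (rule mult_mat_vec[OF Xc x(1)])
        finally have "B *\<^sub>v (X *\<^sub>v x) = a \<cdot>\<^sub>v (X *\<^sub>v x)" .
        moreover have "X *\<^sub>v x \<noteq> 0\<^sub>v n"
        proof
          assume "X *\<^sub>v x = 0\<^sub>v n"
          then have "x = mat_adjoint X *\<^sub>v 0\<^sub>v n" using isometry_image_inj[OF Xc XX x(1)] by simp
          also have "\<dots> = 0\<^sub>v j" using Xc by (intro eq_vecI) auto
          finally show False using x(2) by simp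
        qed
        ultimately have "a \<in> spectrum B" using spectrum_iff[OF c[OF B]] Xx by blast
        then show "a \<in> E" using less.prems(3)[OF B] by blast
      qed
    qed
    have "inj_on (\<lambda>B. (compress U B, compress V B)) S"
      using splitting_determines[OF s] c r by (auto intro!: inj_onI)
    moreover have "finite ((\<lambda>B. (compress U B, compress V B)) ` S)"
      by (rule finite_subset[of _ "compress U ` S \<times> compress V ` S"])
        (use part[OF dims(1,3) r] part[OF dims(2,4) rV] in auto)
    ultimately show ?thesis using finite_imageD by blast
  qed
qed

section \<open>Subgroups of finite index and induced representations\<close>

text \<open>
  Finitely many left cosets; normality is not required, since induction of representations
  replaces passing to a quotient group.
\<close>

definition finite_index :: "'a set \<Rightarrow> ('a, 'b) monoid_scheme \<Rightarrow> bool" where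
  "finite_index K G \<longleftrightarrow> subgroup K G \<and> finite ((\<lambda>g. g <#\<^bsub>G\<^esub> K) ` carrier G)"

lemma (in group) l_coset_eq_iff:
  assumes K: "subgroup K G" and g: "g \<in> carrier G" and h: "h \<in> carrier G"
  shows "g <# K = h <# K \<longleftrightarrow> inv g \<otimes> h \<in> K"
proof
  assume "g <# K = h <# K"
  moreover have "h \<in> h <# K" using subgroup.one_closed[OF K] h by (force simp: l_coset_def)
  ultimately obtain k where "k \<in> K" "h = g \<otimes> k" by (auto simp: l_coset_def)
  then show "inv g \<otimes> h \<in> K" using g subgroup.mem_carrier[OF K] by (simp flip: m_assoc)
next
  assume "inv g \<otimes> h \<in> K"
  moreover have "g \<otimes> (inv g \<otimes> h) = h" using g h by (simp flip: m_assoc)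
  ultimately have "h \<in> g <# K" unfolding l_coset_def by force
  then show "g <# K = h <# K" using l_repr_independence[OF _ g K] by blast
qed

text \<open>
  It suffices that a function with finitely many values distinguishes the left cosets. This covers
  kernels and stabilisers as well as intersections and preimages of subgroups.
\<close>

lemma (in group) finite_indexI:
  assumes K: "subgroup K G" and fin: "finite (c ` carrier G)"
    and eq: "\<And>g h. g \<in> carrier G \<Longrightarrow> h \<in> carrier G \<Longrightarrow> c g = c h \<Longrightarrow> inv g \<otimes> h \<in> K"
  shows "finite_index K G"
proof -
  have "(\<lambda>g. g <# K) ` carrier G \<subseteq> (\<lambda>y. (SOME g. g \<in> carrier G \<and> c g = y) <# K) ` c ` carrier G"
  proof
    fix C assume "C \<in> (\<lambda>g. g <# K) ` carrier G"
    then obtain g where g: "g \<in> carrier G" "C = g <# K" by blast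
    define h where "h = (SOME h. h \<in> carrier G \<and> c h = c g)"
    have "h \<in> carrier G \<and> c h = c g" unfolding h_def by (rule someI[of _ g]) (use g in simp)
    then have "h <# K = C" using l_coset_eq_iff[OF K, of h g] eq[of h g] g by simp
    then show "C \<in> (\<lambda>y. (SOME g. g \<in> carrier G \<and> c g = y) <# K) ` c ` carrier G"
      using g(1) unfolding h_def by blast
  qed
  then have "finite ((\<lambda>g. g <# K) ` carrier G)" by (rule finite_subset) (use fin in simp)
  then show ?thesis using K by (simp add: finite_index_def)
qed

lemma (in group) finite_index_transversal:
  assumes "finite_index K G"
  obtains m :: nat and t where "\<And>i. i < m \<Longrightarrow> t i \<in> carrier G"
    "\<And>g. g \<in> carrier G \<Longrightarrow> \<exists>!i. i < m \<and> inv (t i) \<otimes> g \<in> K"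
proof -
  have K: "subgroup K G" and fin: "finite ((\<lambda>g. g <# K) ` carrier G)"
    using assms by (auto simp: finite_index_def)
  obtain b where b: "bij_betw b {0..<card ((\<lambda>g. g <# K) ` carrier G)} ((\<lambda>g. g <# K) ` carrier G)"
    using ex_bij_betw_nat_finite[OF fin] by blast
  define m where "m = card ((\<lambda>g. g <# K) ` carrier G)"
  define t where "t i = (SOME g. g \<in> carrier G \<and> g <# K = b i)" for i
  have t: "t i \<in> carrier G \<and> t i <# K = b i" if "i < m" for i
  proof -
    have "b i \<in> (\<lambda>g. g <# K) ` carrier G" using bij_betwE[OF b] that unfolding m_def by (metis atLeastLessThan_iff zero_le)
    then have "\<exists>g. g \<in> carrier G \<and> g <# K = b i" by blast
    then show ?thesis unfolding t_def by (rule someI_ex)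
  qed
  have "\<exists>!i. i < m \<and> inv (t i) \<otimes> g \<in> K" if g: "g \<in> carrier G" for g
  proof -
    have "i < m \<and> inv (t i) \<otimes> g \<in> K \<longleftrightarrow> i \<in> {0..<m} \<and> g <# K = b i" for i
      using l_coset_eq_iff[OF K, of "t i" g] t[of i] g by auto
    moreover have "\<exists>!i. i \<in> {0..<m} \<and> g <# K = b i"
      using b g unfolding m_def by (blast dest: bij_betwE bij_betw_imp_inj_on inj_onD bij_betw_imp_surj_on)
    ultimately show ?thesis by simp
  qed
  then show thesis using that t by blast
qed

text \<open>
  Block matrices with \<open>m\<close> by \<open>m\<close> blocks of size \<open>n\<close> are indexed by numbers below \<open>m * n\<close>; quotient
  and remainder modulo \<open>n\<close> are the block index and the index inside a block.
\<close>

lemma sum_div_mod: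
  fixes F :: "nat \<Rightarrow> nat \<Rightarrow> 'a::comm_monoid_add"
  shows "(\<Sum>c = 0..<m * n. F (c div n) (c mod n)) = (\<Sum>i<m. \<Sum>j<n. F i j)"
proof -
  have "(\<Sum>i<m. \<Sum>j<n. F i j) = (\<Sum>(i, j)\<in>{..<m} \<times> {..<n}. F i j)"
    by (simp add: sum.cartesian_product)
  also have "\<dots> = (\<Sum>c = 0..<m * n. F (c div n) (c mod n))"
  proof (rule sum.reindex_bij_witness[of _ "\<lambda>c. (c div n, c mod n)" "\<lambda>(i, j). i * n + j"])
    fix p assume p: "p \<in> {..<m} \<times> {..<n}"
    then obtain i j where ij: "p = (i, j)" "i < m" "j < n" by auto
    have "i * n + j < (i + 1) * n" using ij by simp
    also have "\<dots> \<le> m * n" using ij by (intro mult_right_mono) auto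
    finally show "(case p of (i, j) \<Rightarrow> i * n + j) \<in> {0..<m * n}" using ij by simp
  next
    fix c assume c: "c \<in> {0..<m * n}"
    then have "n > 0" by (cases n) auto
    then show "(c div n, c mod n) \<in> {..<m} \<times> {..<n}"
      using c by (auto simp: less_mult_imp_div_less)
  qed auto
  finally show ?thesis ..
qed

lemma finite_mats_with_entries:
  assumes "finite F"
  shows "finite {A \<in> carrier_mat n m. \<forall>i<n. \<forall>j<m. A $$ (i, j) \<in> F}" (is "finite ?M")
proof -
  have "?M \<subseteq> mat n m ` (({..<n} \<times> {..<m}) \<rightarrow>\<^sub>E F)"
  proof
    fix A assume A: "A \<in> ?M"
    then have "A = mat n m (restrict (($$) A) ({..<n} \<times> {..<m}))" by (intro eq_matI) auto
    moreover have "restrict (($$) A) ({..<n} \<times> {..<m}) \<in> ({..<n} \<times> {..<m}) \<rightarrow>\<^sub>E F" using A by auto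
    ultimately show "A \<in> mat n m ` (({..<n} \<times> {..<m}) \<rightarrow>\<^sub>E F)" by blast
  qed
  then show ?thesis by (rule finite_subset) (simp add: finite_PiE assms)
qed

text \<open>
  The induced representation. For coset representatives \<open>t i\<close> of \<open>K\<close>, the block of \<open>\<pi> g\<close> at \<open>(i, j)\<close>
  is \<open>\<sigma>\<close> at the inverse of \<open>t i\<close> times \<open>g\<close> times \<open>t j\<close>, or zero if this element is not in \<open>K\<close>. Each row
  and each column of blocks has a single nonzero block. The diagonal block at the coset \<open>K\<close> itself is
  conjugate to \<open>\<sigma> g\<close> or zero, so an element acting trivially lies in the kernel of \<open>\<sigma>\<close>.
\<close>

lemma (in group) induced_rep:
  assumes fi: "finite_index K G" and rep: "unitary_rep (G\<lparr>carrier := K\<rparr>) n \<sigma>"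
  obtains N \<pi> where "unitary_rep G N \<pi>" "finite (\<sigma> ` K) \<Longrightarrow> finite (\<pi> ` carrier G)"
    "\<And>g. g \<in> carrier G \<Longrightarrow> \<pi> g = 1\<^sub>m N \<Longrightarrow> g \<in> K \<and> \<sigma> g = 1\<^sub>m n"
proof -
  note G = is_group
  have K: "subgroup K G" using fi by (simp add: finite_index_def)
  interpret K: subgroup K G by (rule K)
  have n: "1 \<le> n" using rep by (simp add: unitary_rep_def)
  note D0 = unitary_repD[OF subgroup_imp_group[OF K] rep]
  have \<sigma>c: "\<sigma> k \<in> carrier_mat n n" if "k \<in> K" for k using D0(2) that by simp
  have \<sigma>m: "\<sigma> (k \<otimes> l) = \<sigma> k * \<sigma> l" if "k \<in> K" "l \<in> K" for k l using D0(3) that by simp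
  have \<sigma>1: "\<sigma> \<one> = 1\<^sub>m n" using D0(4) by simp
  have \<sigma>i: "\<sigma> (inv k) = mat_adjoint (\<sigma> k)" if "k \<in> K" for k
    using D0(5)[of k] that m_inv_consistent[OF K that] by simp
  have \<sigma>u: "\<sigma> k * mat_adjoint (\<sigma> k) = 1\<^sub>m n" "mat_adjoint (\<sigma> k) * \<sigma> k = 1\<^sub>m n" if "k \<in> K" for k
    using D0(6,7)[of k] that by auto
  obtain m :: nat and t where t: "\<And>i. i < m \<Longrightarrow> t i \<in> carrier G"
    and ex1: "\<And>g. g \<in> carrier G \<Longrightarrow> \<exists>!i. i < m \<and> inv (t i) \<otimes> g \<in> K"
    using finite_index_transversal[OF fi] by blast
  \<comment> \<open>\<open>\<sigma>\<close> extended by zero to the whole group; the blocks of the induced representation are its values.\<close>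
  define s where "s a = (if a \<in> K then \<sigma> a else 0\<^sub>m n n)" for a
  have sc: "s a \<in> carrier_mat n n" for a using \<sigma>c by (simp add: s_def)
  have sd: "dim_row (s a) = n" "dim_col (s a) = n" for a using sc[of a] by auto
  have s_mult: "s (a \<otimes> b) = s a * s b" if a: "a \<in> carrier G" and b: "b \<in> K" for a b
  proof -
    have "a \<otimes> b \<in> K \<longleftrightarrow> a \<in> K"
    proof
      assume "a \<otimes> b \<in> K"
      then have "a \<otimes> b \<otimes> inv b \<in> K" using b by simp
      then show "a \<in> K" using a b by (simp add: m_assoc)
    qed (use b in simp)
    then show ?thesis using b \<sigma>m \<sigma>c[OF b] by (simp add: s_def)
  qed
  have s_inv: "s (inv a) = mat_adjoint (s a)" if "a \<in> carrier G" for a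
  proof -
    have "inv a \<in> K \<longleftrightarrow> a \<in> K" using that K.m_inv_closed[of a] K.m_inv_closed[of "inv a"] by auto
    moreover have "mat_adjoint (0\<^sub>m n n :: complex mat) = 0\<^sub>m n n" by (rule eq_matI) auto
    ultimately show ?thesis by (simp add: s_def \<sigma>i)
  qed
  define \<pi> where "\<pi> g = mat (m * n) (m * n)
    (\<lambda>(r, c). s (inv (t (r div n)) \<otimes> g \<otimes> t (c div n)) $$ (r mod n, c mod n))" for g
  have \<pi>c: "\<pi> g \<in> carrier_mat (m * n) (m * n)" for g by (simp add: \<pi>_def)
  have dm: "r div n < m" "r mod n < n" if "r < m * n" for r
    using that n by (auto simp: less_mult_imp_div_less)
  have m0: "0 < m" using ex1[of \<one>] by auto
  have mult: "\<pi> (g \<otimes> h) = \<pi> g * \<pi> h" if g: "g \<in> carrier G" and h: "h \<in> carrier G" for g h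
  proof (rule eq_matI)
    fix r c assume "r < dim_row (\<pi> g * \<pi> h)" "c < dim_col (\<pi> g * \<pi> h)"
    then have rc: "r < m * n" "c < m * n" using \<pi>c[of g] \<pi>c[of h] by auto
    define x where "x = inv (t (r div n)) \<otimes> g"
    define y where "y = h \<otimes> t (c div n)"
    have x: "x \<in> carrier G" and y: "y \<in> carrier G" unfolding x_def y_def using t dm rc g h by auto
    obtain i where i: "i < m" "inv (t i) \<otimes> y \<in> K" and uniq: "\<And>j. j < m \<Longrightarrow> inv (t j) \<otimes> y \<in> K \<Longrightarrow> j = i"
      using ex1[OF y] by blast
    have "(\<pi> g * \<pi> h) $$ (r, c) = (\<Sum>l = 0..<m * n. \<pi> g $$ (r, l) * \<pi> h $$ (l, c))"
      using rc \<pi>c[of g] \<pi>c[of h] by (auto simp: scalar_prod_def)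
    also have "\<dots> = (\<Sum>l = 0..<m * n. s (x \<otimes> t (l div n)) $$ (r mod n, l mod n) *
        s (inv (t (l div n)) \<otimes> y) $$ (l mod n, c mod n))"
      using rc g h t dm by (intro sum.cong) (auto simp: \<pi>_def x_def y_def m_assoc)
    also have "\<dots> = (\<Sum>j<m. \<Sum>l<n. s (x \<otimes> t j) $$ (r mod n, l) * s (inv (t j) \<otimes> y) $$ (l, c mod n))"
      by (rule sum_div_mod[of "\<lambda>j l. s (x \<otimes> t j) $$ (r mod n, l) * s (inv (t j) \<otimes> y) $$ (l, c mod n)"])
    also have "\<dots> = (\<Sum>j\<in>{i}. \<Sum>l<n. s (x \<otimes> t j) $$ (r mod n, l) * s (inv (t j) \<otimes> y) $$ (l, c mod n))"
    proof (rule sum.mono_neutral_right)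
      show "\<forall>j\<in>{..<m} - {i}. (\<Sum>l<n. s (x \<otimes> t j) $$ (r mod n, l) * s (inv (t j) \<otimes> y) $$ (l, c mod n)) = 0"
      proof
        fix j assume "j \<in> {..<m} - {i}"
        then have "inv (t j) \<otimes> y \<notin> K" using uniq by auto
        then show "(\<Sum>l<n. s (x \<otimes> t j) $$ (r mod n, l) * s (inv (t j) \<otimes> y) $$ (l, c mod n)) = 0"
          using rc dm by (simp add: s_def[of "inv (t j) \<otimes> y"])
      qed
    qed (use i in auto)
    also have "\<dots> = (s (x \<otimes> t i) * s (inv (t i) \<otimes> y)) $$ (r mod n, c mod n)"
      using rc dm sd by (auto simp: scalar_prod_def atLeast0LessThan)
    also have "s (x \<otimes> t i) * s (inv (t i) \<otimes> y) = s (x \<otimes> t i \<otimes> (inv (t i) \<otimes> y))"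
      by (rule s_mult[symmetric]) (use x t i in auto)
    also have "x \<otimes> t i \<otimes> (inv (t i) \<otimes> y) = x \<otimes> y"
      using x y t[OF i(1)] by (simp add: m_assoc) (simp flip: m_assoc)
    also have "x \<otimes> y = inv (t (r div n)) \<otimes> (g \<otimes> h) \<otimes> t (c div n)"
      unfolding x_def y_def using g h t dm rc by (simp add: m_assoc)
    finally show "\<pi> (g \<otimes> h) $$ (r, c) = (\<pi> g * \<pi> h) $$ (r, c)"
      using rc by (simp add: \<pi>_def)
  qed (auto simp: \<pi>_def)
  have one: "\<pi> \<one> = 1\<^sub>m (m * n)"
  proof (rule eq_matI)
    fix r c assume "r < dim_row (1\<^sub>m (m * n) :: complex mat)" "c < dim_col (1\<^sub>m (m * n) :: complex mat)"
    then have rc: "r < m * n" "c < m * n" by auto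
    have tt: "t (r div n) \<in> carrier G" "t (c div n) \<in> carrier G" using rc dm t by auto
    have same: "inv (t (r div n)) \<otimes> t (c div n) \<in> K \<longleftrightarrow> r div n = c div n"
      using ex1[OF tt(2)] tt dm[OF rc(1)] dm[OF rc(2)] l_inv[OF tt(2)] K.one_closed by (metis)
    have "s (inv (t (r div n)) \<otimes> t (c div n)) = (if r div n = c div n then 1\<^sub>m n else 0\<^sub>m n n)"
      using same tt by (auto simp: s_def \<sigma>1)
    then have "\<pi> \<one> $$ (r, c) = (if r div n = c div n then 1\<^sub>m n else 0\<^sub>m n n) $$ (r mod n, c mod n)"
      using rc tt by (simp add: \<pi>_def)
    also have "\<dots> = (if r div n = c div n \<and> r mod n = c mod n then 1 else 0)"
      using dm[OF rc(1)] dm[OF rc(2)] by auto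
    also have "r div n = c div n \<and> r mod n = c mod n \<longleftrightarrow> r = c" by (metis div_mult_mod_eq)
    finally show "\<pi> \<one> $$ (r, c) = 1\<^sub>m (m * n) $$ (r, c)" using rc by simp
  qed (use \<pi>c in auto)
  have adj: "\<pi> (inv g) = mat_adjoint (\<pi> g)" if g: "g \<in> carrier G" for g
  proof (rule eq_matI)
    fix r c assume "r < dim_row (mat_adjoint (\<pi> g))" "c < dim_col (mat_adjoint (\<pi> g))"
    then have rc: "r < m * n" "c < m * n" using \<pi>c[of g] by auto
    have tt: "t (r div n) \<in> carrier G" "t (c div n) \<in> carrier G" using rc dm t by auto
    have e: "inv (t (r div n)) \<otimes> inv g \<otimes> t (c div n) = inv (inv (t (c div n)) \<otimes> g \<otimes> t (r div n))"
      using g tt by (simp add: inv_mult_group m_assoc)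
    have "s (inv (t (r div n)) \<otimes> inv g \<otimes> t (c div n)) = mat_adjoint (s (inv (t (c div n)) \<otimes> g \<otimes> t (r div n)))"
      unfolding e by (rule s_inv) (use g tt in auto)
    then show "\<pi> (inv g) $$ (r, c) = mat_adjoint (\<pi> g) $$ (r, c)"
      using rc \<pi>c[of g] dm sd by (simp add: \<pi>_def)
  qed (use \<pi>c[of g] \<pi>c[of "inv g"] in auto)
  have rep\<pi>: "unitary_rep G (m * n) \<pi>"
    using m0 n by (intro unitary_repI[OF G] \<pi>c mult one adj) auto
  have "g \<in> K \<and> \<sigma> g = 1\<^sub>m n" if g: "g \<in> carrier G" and \<pi>g: "\<pi> g = 1\<^sub>m (m * n)" for g
  proof -
    obtain i where i: "i < m" "inv (t i) \<otimes> \<one> \<in> K" using ex1[of \<one>] by blast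
    define u where "u = t i"
    have uG: "u \<in> carrier G" unfolding u_def using t i by simp
    then have uK: "u \<in> K" using i K.m_inv_closed[of "inv u"] unfolding u_def by simp
    have "s (inv u \<otimes> g \<otimes> u) = 1\<^sub>m n"
    proof (rule eq_matI)
      fix a b assume "a < dim_row (1\<^sub>m n :: complex mat)" "b < dim_col (1\<^sub>m n :: complex mat)"
      then have ab: "a < n" "b < n" by auto
      have lt: "i * n + e < m * n" if "e < n" for e
      proof -
        have "i * n + e < (i + 1) * n" using that by simp
        also have "\<dots> \<le> m * n" using i by (intro mult_right_mono) auto
        finally show ?thesis .
      qed
      have "\<pi> g $$ (i * n + a, i * n + b) = s (inv u \<otimes> g \<otimes> u) $$ (a, b)"
        using lt[OF ab(1)] lt[OF ab(2)] ab unfolding \<pi>_def u_def by simp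
      then show "s (inv u \<otimes> g \<otimes> u) $$ (a, b) = 1\<^sub>m n $$ (a, b)"
        unfolding \<pi>g using lt[OF ab(1)] lt[OF ab(2)] ab by simp
    qed (use sd in auto)
    moreover have "(0\<^sub>m n n :: complex mat) $$ (0, 0) \<noteq> 1\<^sub>m n $$ (0, 0)" using n by simp
    ultimately have k: "inv u \<otimes> g \<otimes> u \<in> K" and \<sigma>k: "\<sigma> (inv u \<otimes> g \<otimes> u) = 1\<^sub>m n"
      unfolding s_def by (metis)+
    have gk: "g = u \<otimes> (inv u \<otimes> g \<otimes> u) \<otimes> inv u"
      using uG g by (simp add: m_assoc) (simp flip: m_assoc)
    have gK: "g \<in> K" by (subst gk) (use uK k in simp)
    have "\<sigma> g = \<sigma> u * \<sigma> (inv u \<otimes> g \<otimes> u) * \<sigma> (inv u)"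
      by (subst gk) (use uK k in \<open>simp only: \<sigma>m K.m_closed K.m_inv_closed\<close>)
    also have "\<dots> = 1\<^sub>m n" unfolding \<sigma>k right_mult_one_mat[OF \<sigma>c[OF uK]] using uK \<sigma>u \<sigma>i by simp
    finally show ?thesis using gK by simp
  qed
  moreover have "finite (\<pi> ` carrier G)" if fin: "finite (\<sigma> ` K)"
  proof -
    define F where "F = insert 0 (\<Union>A\<in>\<sigma> ` K. (\<lambda>(i, j). A $$ (i, j)) ` ({..<n} \<times> {..<n}))"
    have "finite F" unfolding F_def by (intro finite.insertI finite_UN_I fin finite_imageI) auto
    have sF: "s a $$ (i, j) \<in> F" if "i < n" "j < n" for a i j
      using that unfolding s_def F_def by force
    have "\<pi> ` carrier G \<subseteq> {A \<in> carrier_mat (m * n) (m * n). \<forall>i<m * n. \<forall>j<m * n. A $$ (i, j) \<in> F}"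
      using \<pi>c sF dm by (auto simp: \<pi>_def)
    then show ?thesis using finite_mats_with_entries[OF \<open>finite F\<close>] finite_subset by blast
  qed
  ultimately show thesis using that rep\<pi> by blast
qed

text \<open>
  Kernels of representations with finite image have finite index; conversely the trivial representation
  of \<open>K\<close> induces the permutation representation on the cosets of \<open>K\<close>, in which only elements of
  \<open>K\<close> can act trivially.
\<close>

lemma (in group) separated_iff_finite_index:
  shows "unitarily_separated True G \<longleftrightarrow> (\<forall>g\<in>carrier G. g \<noteq> \<one>\<^bsub>G\<^esub> \<longrightarrow> (\<exists>K. finite_index K G \<and> g \<notin> K))"
proof (intro iffI ballI impI)
  note G = is_group
  fix g assume sep: "unitarily_separated True G" and g: "g \<in> carrier G" "g \<noteq> \<one>\<^bsub>G\<^esub>"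
  then obtain n \<pi> where rep: "unitary_rep G n \<pi>" and fin: "finite (\<pi> ` carrier G)" and \<pi>g: "\<pi> g \<noteq> 1\<^sub>m n"
    unfolding unitarily_separated_def by blast
  note D = unitary_repD[OF G rep]
  define K where "K = {k \<in> carrier G. \<pi> k = 1\<^sub>m n}"
  have K: "subgroup K G" by (rule subgroupI) (auto simp: K_def D)
  have "finite_index K G"
    by (rule finite_indexI[OF K fin]) (auto simp: K_def D)
  then show "\<exists>K. finite_index K G \<and> g \<notin> K" using \<pi>g unfolding K_def by blast
next
  assume R: "\<forall>g\<in>carrier G. g \<noteq> \<one>\<^bsub>G\<^esub> \<longrightarrow> (\<exists>K. finite_index K G \<and> g \<notin> K)"
  show "unitarily_separated True G"
    unfolding unitarily_separated_def
  proof (intro ballI impI)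
    fix g assume g: "g \<in> carrier G" "g \<noteq> \<one>\<^bsub>G\<^esub>"
    then obtain K where K: "finite_index K G" "g \<notin> K" using R by blast
    have sub: "subgroup K G" using K by (simp add: finite_index_def)
    have triv: "unitary_rep (G\<lparr>carrier := K\<rparr>) 1 (\<lambda>_. 1\<^sub>m 1)"
      by (rule unitary_repI[OF subgroup_imp_group[OF sub]]) auto
    obtain N \<pi> where "unitary_rep G N \<pi>" "finite ((\<lambda>_. 1\<^sub>m 1 :: complex mat) ` K) \<Longrightarrow> finite (\<pi> ` carrier G)"
      "\<And>g. g \<in> carrier G \<Longrightarrow> \<pi> g = 1\<^sub>m N \<Longrightarrow> g \<in> K \<and> (1\<^sub>m 1 :: complex mat) = 1\<^sub>m 1"
      using induced_rep[OF K(1) triv] by blast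
    moreover have "finite ((\<lambda>_. 1\<^sub>m 1 :: complex mat) ` K)" by (rule finite_subset[of _ "{1\<^sub>m 1}"]) auto
    ultimately show "\<exists>n \<pi>. unitary_rep G n \<pi> \<and> (True \<longrightarrow> finite (\<pi> ` carrier G)) \<and> \<pi> g \<noteq> 1\<^sub>m n"
      using K(2) g by blast
  qed
qed

section \<open>Wreath products\<close>

lemma unitarily_separated_mono:
  "unitarily_separated True G \<Longrightarrow> unitarily_separated fin G"
  unfolding unitarily_separated_def by blast

lemma separated_via_hom:
  assumes sep: "unitarily_separated fin G" and \<phi>: "\<phi> \<in> hom K G" and g: "g \<in> carrier K" and ne: "\<phi> g \<noteq> \<one>\<^bsub>G\<^esub>"
  shows "\<exists>n \<pi>. unitary_rep K n \<pi> \<and> (fin \<longrightarrow> finite (\<pi> ` carrier K)) \<and> \<pi> g \<noteq> 1\<^sub>m n"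
proof -
  have im: "\<phi> ` carrier K \<subseteq> carrier G" using \<phi> by (auto simp: hom_def)
  then obtain n \<pi> where \<pi>: "unitary_rep G n \<pi>" "fin \<longrightarrow> finite (\<pi> ` carrier G)" "\<pi> (\<phi> g) \<noteq> 1\<^sub>m n"
    using sep g ne unfolding unitarily_separated_def by blast
  have "(\<lambda>x. \<pi> (\<phi> x)) ` carrier K \<subseteq> \<pi> ` carrier G" using im by blast
  then have "fin \<longrightarrow> finite ((\<lambda>x. \<pi> (\<phi> x)) ` carrier K)" using \<pi>(2) finite_subset by blast
  then show ?thesis using unitary_rep_comp[OF \<pi>(1) \<phi>] \<pi>(3) by blast
qed

locale wreath = L: group L + H: group H
  for L :: "('a, 'b) monoid_scheme" and H :: "('c, 'd) monoid_scheme"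
begin

abbreviation S where "S \<equiv> sum_group (carrier H) (\<lambda>_. L)"
abbreviation W where "W \<equiv> wreath_product L H"

sublocale W: group W
  by (rule group_wreath_product[OF L.is_group H.is_group])

sublocale S: group S
  by (simp add: L.is_group)

lemma carrier_S: "f \<in> carrier S \<longleftrightarrow> f \<in> carrier H \<rightarrow>\<^sub>E carrier L \<and> finite {h \<in> carrier H. f h \<noteq> \<one>\<^bsub>L\<^esub>}"
  by (simp add: carrier_sum_group L.is_group)

lemma S_closed: "f \<in> carrier S \<Longrightarrow> h \<in> carrier H \<Longrightarrow> f h \<in> carrier L"
  by (auto simp: carrier_S)

lemma carrier_W: "(f, h) \<in> carrier W \<longleftrightarrow> f \<in> carrier S \<and> h \<in> carrier H"
  by (simp add: wreath_product_def semidirect_product_def)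

lemma mult_W: "(f, h) \<otimes>\<^bsub>W\<^esub> (g, k) = (f \<otimes>\<^bsub>S\<^esub> shift_action H h g, h \<otimes>\<^bsub>H\<^esub> k)"
  by (simp add: wreath_product_def semidirect_product_def)

lemma one_W: "\<one>\<^bsub>W\<^esub> = (\<one>\<^bsub>S\<^esub>, \<one>\<^bsub>H\<^esub>)"
  by (simp add: wreath_product_def semidirect_product_def)

lemma snd_hom: "snd \<in> hom W H"
  by (auto simp: hom_def carrier_W mult_W)

text \<open>
  \<open>\<delta> k a\<close> is the element \<open>a\<close> in the copy of \<open>L\<close> at the position \<open>k\<close>, and \<open>\<tau>\<close> embeds \<open>H\<close>.
\<close>

definition \<delta> :: "'c \<Rightarrow> 'a \<Rightarrow> ('c \<Rightarrow> 'a) \<times> 'c" where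
  "\<delta> k a = ((\<lambda>x\<in>carrier H. if x = k then a else \<one>\<^bsub>L\<^esub>), \<one>\<^bsub>H\<^esub>)"

definition \<tau> :: "'c \<Rightarrow> ('c \<Rightarrow> 'a) \<times> 'c" where
  "\<tau> h = (\<one>\<^bsub>S\<^esub>, h)"

lemma \<delta>_closed [simp]: "a \<in> carrier L \<Longrightarrow> \<delta> k a \<in> carrier W"
proof -
  assume "a \<in> carrier L"
  moreover have "finite {h \<in> carrier H. (\<lambda>x\<in>carrier H. if x = k then a else \<one>\<^bsub>L\<^esub>) h \<noteq> \<one>\<^bsub>L\<^esub>}"
    by (rule finite_subset[of _ "{k}"]) auto
  ultimately show ?thesis by (simp add: \<delta>_def carrier_W carrier_S)
qed

lemma \<tau>_closed [simp]: "h \<in> carrier H \<Longrightarrow> \<tau> h \<in> carrier W"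
  by (simp add: \<tau>_def carrier_W del: one_sum_group)

lemma shift_id: "f \<in> carrier S \<Longrightarrow> shift_action H \<one>\<^bsub>H\<^esub> f = f"
  by (auto simp: shift_action_def carrier_S fun_eq_iff PiE_iff extensional_def)

lemma \<tau>_\<delta>:
  assumes "h \<in> carrier H" "k \<in> carrier H" "a \<in> carrier L"
  shows "\<tau> h \<otimes>\<^bsub>W\<^esub> \<delta> k a = \<delta> (h \<otimes>\<^bsub>H\<^esub> k) a \<otimes>\<^bsub>W\<^esub> \<tau> h"
proof -
  have "inv\<^bsub>H\<^esub> h \<otimes>\<^bsub>H\<^esub> x = k \<longleftrightarrow> x = h \<otimes>\<^bsub>H\<^esub> k" if "x \<in> carrier H" for x
    using assms that H.inv_solve_left'[of k h x] by auto
  then show ?thesis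
    using assms by (auto simp: \<tau>_def \<delta>_def mult_W shift_action_def fun_eq_iff)
qed

lemma \<delta>_mult:
  assumes "k \<in> carrier H" "a \<in> carrier L" "b \<in> carrier L"
  shows "\<delta> k a \<otimes>\<^bsub>W\<^esub> \<delta> k b = \<delta> k (a \<otimes>\<^bsub>L\<^esub> b)"
  using assms by (auto simp: \<delta>_def mult_W shift_action_def fun_eq_iff)

lemma \<delta>_commute:
  assumes "k \<in> carrier H" "j \<in> carrier H" "k \<noteq> j" "a \<in> carrier L" "b \<in> carrier L"
  shows "\<delta> k a \<otimes>\<^bsub>W\<^esub> \<delta> j b = \<delta> j b \<otimes>\<^bsub>W\<^esub> \<delta> k a"
  using assms by (auto simp: \<delta>_def mult_W shift_action_def fun_eq_iff)

lemma \<delta>_eq_iff: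
  assumes "k \<in> carrier H" "j \<in> carrier H" "a \<noteq> \<one>\<^bsub>L\<^esub>"
  shows "\<delta> k a = \<delta> j b \<longleftrightarrow> k = j \<and> a = b"
proof
  assume "\<delta> k a = \<delta> j b"
  then have "(\<lambda>x\<in>carrier H. if x = k then a else \<one>\<^bsub>L\<^esub>) k = (\<lambda>x\<in>carrier H. if x = j then b else \<one>\<^bsub>L\<^esub>) k"
    unfolding \<delta>_def by (metis prod.inject)
  then show "k = j \<and> a = b" using assms by (auto split: if_splits)
qed simp

lemma \<delta>_hom: "\<delta> \<one>\<^bsub>H\<^esub> \<in> hom L W"
  using \<delta>_mult[of "\<one>\<^bsub>H\<^esub>"] by (auto simp: hom_def)

lemma rep_conj:
  assumes rep: "unitary_rep W n \<pi>" and "h \<in> carrier H" "k \<in> carrier H" "a \<in> carrier L"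
  shows "\<pi> (\<delta> (h \<otimes>\<^bsub>H\<^esub> k) a) = \<pi> (\<tau> h) * \<pi> (\<delta> k a) * mat_adjoint (\<pi> (\<tau> h))"
proof -
  note D = unitary_repD[OF W.is_group rep]
  have c: "\<pi> (\<delta> (h \<otimes>\<^bsub>H\<^esub> k) a) \<in> carrier_mat n n" "\<pi> (\<tau> h) \<in> carrier_mat n n"
    using D(2) assms by auto
  have "\<pi> (\<tau> h) * \<pi> (\<delta> k a) = \<pi> (\<delta> (h \<otimes>\<^bsub>H\<^esub> k) a) * \<pi> (\<tau> h)"
    using assms \<tau>_\<delta>[of h k a] D(3)[of "\<tau> h" "\<delta> k a"] D(3)[of "\<delta> (h \<otimes>\<^bsub>H\<^esub> k) a" "\<tau> h"] by simp
  then have "\<pi> (\<tau> h) * \<pi> (\<delta> k a) * mat_adjoint (\<pi> (\<tau> h))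
      = \<pi> (\<delta> (h \<otimes>\<^bsub>H\<^esub> k) a) * (\<pi> (\<tau> h) * mat_adjoint (\<pi> (\<tau> h)))"
    using assoc_mult_mat[OF c mat_adjoint_carrier[OF c(2)]] by simp
  also have "\<dots> = \<pi> (\<delta> (h \<otimes>\<^bsub>H\<^esub> k) a)" using assms c D(6)[of "\<tau> h"] by simp
  finally show ?thesis by simp
qed

text \<open>
  The key fact for the forward direction. The matrices \<open>\<pi> (\<delta> k a)\<close>, for \<open>k\<close> in \<open>H\<close>, commute because
  different positions commute, and they have the same spectrum because \<open>\<tau> k\<close> conjugates one into the
  other.
\<close>

lemma finite_rep_\<delta>:
  assumes rep: "unitary_rep W n \<pi>" and a: "a \<in> carrier L"
  shows "finite ((\<lambda>k. \<pi> (\<delta> k a)) ` carrier H)"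
proof -
  note D = unitary_repD[OF W.is_group rep]
  have c1: "\<pi> (\<delta> \<one>\<^bsub>H\<^esub> a) \<in> carrier_mat n n" using D(2) a by simp
  show ?thesis
  proof (rule finite_commuting_unitaries[OF card_finite_spectrum(1)[OF c1]])
    show "(\<lambda>k. \<pi> (\<delta> k a)) ` carrier H \<subseteq> carrier (unitary_group n)"
      using D(1)[OF \<delta>_closed[OF a]] by blast
  next
    fix A B assume "A \<in> (\<lambda>k. \<pi> (\<delta> k a)) ` carrier H" "B \<in> (\<lambda>k. \<pi> (\<delta> k a)) ` carrier H"
    then obtain k j where kj: "k \<in> carrier H" "j \<in> carrier H" and AB: "A = \<pi> (\<delta> k a)" "B = \<pi> (\<delta> j a)" by blast
    show "A * B = B * A"
    proof (cases "k = j")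
      case False
      then have "\<pi> (\<delta> k a \<otimes>\<^bsub>W\<^esub> \<delta> j a) = \<pi> (\<delta> j a \<otimes>\<^bsub>W\<^esub> \<delta> k a)" using \<delta>_commute kj a by simp
      then show ?thesis unfolding AB using a by (simp add: D(3))
    qed (use AB in simp)
  next
    fix A assume "A \<in> (\<lambda>k. \<pi> (\<delta> k a)) ` carrier H"
    then obtain k where k: "k \<in> carrier H" and A: "A = \<pi> (\<delta> k a)" by blast
    define B where "B = \<pi> (\<delta> \<one>\<^bsub>H\<^esub> a)"
    define U where "U = \<pi> (\<tau> k)"
    have c: "A \<in> carrier_mat n n" "B \<in> carrier_mat n n" "U \<in> carrier_mat n n"
      unfolding A B_def U_def using D(2) a k by auto
    have u: "U * mat_adjoint U = 1\<^sub>m n" "mat_adjoint U * U = 1\<^sub>m n"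
      unfolding U_def using D(6,7)[of "\<tau> k"] k by auto
    have AU: "A = U * B * mat_adjoint U"
      using rep_conj[OF rep k H.one_closed a] k unfolding A B_def U_def by simp
    have UA: "mat_adjoint U * A = B * mat_adjoint U"
    proof -
      have "mat_adjoint U * A = mat_adjoint U * U * (B * mat_adjoint U)"
        unfolding AU using c by (auto simp: mat_assoc)
      also have "\<dots> = B * mat_adjoint U"
        unfolding u(2) by (rule left_mult_one_mat, rule mult_carrier_mat[of _ n n]) (use c in auto)
      finally show ?thesis .
    qed
    show "spectrum A \<subseteq> spectrum (\<pi> (\<delta> \<one>\<^bsub>H\<^esub> a))"
    proof
      fix l assume "l \<in> spectrum A"
      then obtain v where v: "v \<in> carrier_vec n" "v \<noteq> 0\<^sub>v n" "A *\<^sub>v v = l \<cdot>\<^sub>v v"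
        using spectrum_iff[OF c(1)] by blast
      define w where "w = mat_adjoint U *\<^sub>v v"
      have w: "w \<in> carrier_vec n" unfolding w_def by (rule mult_mat_vec_carrier_dim) (use c in auto)
      have "B *\<^sub>v w = B * mat_adjoint U *\<^sub>v v"
        unfolding w_def by (rule assoc_mult_mat_vec[OF c(2) mat_adjoint_carrier[OF c(3)] v(1), symmetric])
      also have "\<dots> = mat_adjoint U *\<^sub>v (A *\<^sub>v v)"
        unfolding UA[symmetric] by (rule assoc_mult_mat_vec[OF mat_adjoint_carrier[OF c(3)] c(1) v(1)])
      also have "\<dots> = l \<cdot>\<^sub>v w"
        unfolding v(3) w_def by (rule mult_mat_vec[OF mat_adjoint_carrier[OF c(3)] v(1)])
      finally have "B *\<^sub>v w = l \<cdot>\<^sub>v w" .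
      moreover have "w \<noteq> 0\<^sub>v n"
      proof
        assume w0: "w = 0\<^sub>v n"
        have "v = U * mat_adjoint U *\<^sub>v v" unfolding u using v by simp
        also have "\<dots> = U *\<^sub>v w" unfolding w_def by (rule assoc_mult_mat_vec[OF c(3) mat_adjoint_carrier[OF c(3)] v(1)])
        also have "\<dots> = 0\<^sub>v n" unfolding w0 using c by (intro eq_vecI) auto
        finally show False using v(2) by simp
      qed
      ultimately show "l \<in> spectrum (\<pi> (\<delta> \<one>\<^bsub>H\<^esub> a))"
        using spectrum_iff[OF c(2)] w unfolding B_def by blast
    qed
  qed
qed

lemma rep_\<delta>_translate:
  assumes rep: "unitary_rep W n \<pi>" and "h \<in> carrier H" "j \<in> carrier H" "k \<in> carrier H" "a \<in> carrier L"
    and "\<pi> (\<delta> j a) = \<pi> (\<delta> k a)"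
  shows "\<pi> (\<delta> (h \<otimes>\<^bsub>H\<^esub> j) a) = \<pi> (\<delta> (h \<otimes>\<^bsub>H\<^esub> k) a)"
  using assms by (simp add: rep_conj)

lemma rep_separating:
  assumes sep: "unitarily_separated fin W" and x: "x \<in> carrier W" "y \<in> carrier W" "x \<noteq> y"
  obtains n \<pi> where "unitary_rep W n \<pi>" "\<pi> x \<noteq> \<pi> y"
  using sep x unfolding separates_points_iff[OF W.is_group, symmetric] irreducible_unitary_rep_def by blast

text \<open>
  For \<open>a \<noteq> \<one>\<close>, the group \<open>H\<close> permutes the finite set of all \<open>\<pi> (\<delta> k a)\<close> by conjugation. The stabiliser \<open>K\<close>
  of the point with \<open>k = \<one>\<close> has finite index, and \<open>\<pi>\<close> can be chosen such that \<open>h\<close> moves this point.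
\<close>

lemma separated_imp_top_residually_finite:
  assumes sep: "unitarily_separated fin W" and nontriv: "\<exists>x\<in>carrier L. \<exists>y\<in>carrier L. x \<noteq> y"
  shows "unitarily_separated True H"
  unfolding H.separated_iff_finite_index
proof (intro ballI impI)
  fix h assume h: "h \<in> carrier H" "h \<noteq> \<one>\<^bsub>H\<^esub>"
  obtain a where a: "a \<in> carrier L" "a \<noteq> \<one>\<^bsub>L\<^esub>" using nontriv by metis
  obtain n \<pi> where rep: "unitary_rep W n \<pi>" and ne: "\<pi> (\<delta> h a) \<noteq> \<pi> (\<delta> \<one>\<^bsub>H\<^esub> a)"
    using rep_separating[OF sep, of "\<delta> h a" "\<delta> \<one>\<^bsub>H\<^esub> a"] \<delta>_eq_iff[of h "\<one>\<^bsub>H\<^esub>" a a] h a by auto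
  define c where "c k = \<pi> (\<delta> k a)" for k
  have tr: "c (k \<otimes>\<^bsub>H\<^esub> i) = c (k \<otimes>\<^bsub>H\<^esub> j)" if "k \<in> carrier H" "i \<in> carrier H" "j \<in> carrier H" "c i = c j" for k i j
    using rep_\<delta>_translate[OF rep that(1-3) a(1)] that(4) unfolding c_def by blast
  define K where "K = {k \<in> carrier H. c k = c \<one>\<^bsub>H\<^esub>}"
  have K: "subgroup K H"
  proof (rule H.subgroupI)
    fix k assume k: "k \<in> K"
    then show "inv\<^bsub>H\<^esub> k \<in> K" using tr[of "inv\<^bsub>H\<^esub> k" k "\<one>\<^bsub>H\<^esub>"] unfolding K_def by simp
    fix j assume "j \<in> K"
    then show "k \<otimes>\<^bsub>H\<^esub> j \<in> K" using k tr[of k j "\<one>\<^bsub>H\<^esub>"] unfolding K_def by simp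
  qed (auto simp: K_def)
  have "finite_index K H"
  proof (rule H.finite_indexI[OF K])
    show "finite (c ` carrier H)" unfolding c_def by (rule finite_rep_\<delta>[OF rep a(1)])
    fix g j assume "g \<in> carrier H" "j \<in> carrier H" "c g = c j"
    then show "inv\<^bsub>H\<^esub> g \<otimes>\<^bsub>H\<^esub> j \<in> K" using tr[of "inv\<^bsub>H\<^esub> g" g j] unfolding K_def by simp
  qed
  moreover have "h \<notin> K" using ne unfolding K_def c_def by simp
  ultimately show "\<exists>K. finite_index K H \<and> h \<notin> K" by blast
qed

text \<open>
  If \<open>H\<close> is infinite, two of the finitely many matrices \<open>\<pi> (\<delta> k a)\<close> coincide, and by translation one of
  the coinciding positions can be taken to be \<open>\<one>\<close>. Then \<open>\<pi> (\<delta> \<one> a)\<close> equals a matrix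
  \<open>\<pi> (\<delta> j a)\<close> with \<open>j \<noteq> \<one>\<close>, which commutes with \<open>\<pi> (\<delta> \<one> b)\<close>. So no \<open>\<pi>\<close> distinguishes \<open>a b\<close> from \<open>b a\<close>.
\<close>

lemma separated_imp_base_abelian:
  assumes sep: "unitarily_separated fin W" and inf: "infinite (carrier H)"
  shows "comm_group L"
proof (rule L.group_comm_groupI, rule ccontr)
  fix a b assume a: "a \<in> carrier L" and b: "b \<in> carrier L" and ne: "a \<otimes>\<^bsub>L\<^esub> b \<noteq> b \<otimes>\<^bsub>L\<^esub> a"
  have "\<delta> \<one>\<^bsub>H\<^esub> (a \<otimes>\<^bsub>L\<^esub> b) \<noteq> \<delta> \<one>\<^bsub>H\<^esub> (b \<otimes>\<^bsub>L\<^esub> a)"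
    using ne \<delta>_eq_iff[of "\<one>\<^bsub>H\<^esub>" "\<one>\<^bsub>H\<^esub>" "a \<otimes>\<^bsub>L\<^esub> b" "b \<otimes>\<^bsub>L\<^esub> a"]
      \<delta>_eq_iff[of "\<one>\<^bsub>H\<^esub>" "\<one>\<^bsub>H\<^esub>" "b \<otimes>\<^bsub>L\<^esub> a" "a \<otimes>\<^bsub>L\<^esub> b"] by fastforce
  then obtain n \<pi> where rep: "unitary_rep W n \<pi>"
    and ne\<pi>: "\<pi> (\<delta> \<one>\<^bsub>H\<^esub> (a \<otimes>\<^bsub>L\<^esub> b)) \<noteq> \<pi> (\<delta> \<one>\<^bsub>H\<^esub> (b \<otimes>\<^bsub>L\<^esub> a))"
    using rep_separating[OF sep, of "\<delta> \<one>\<^bsub>H\<^esub> (a \<otimes>\<^bsub>L\<^esub> b)" "\<delta> \<one>\<^bsub>H\<^esub> (b \<otimes>\<^bsub>L\<^esub> a)"] a b by auto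
  note D = unitary_repD[OF W.is_group rep]
  have "\<not> inj_on (\<lambda>k. \<pi> (\<delta> k a)) (carrier H)"
    using finite_imageD[OF finite_rep_\<delta>[OF rep a]] inf by blast
  then obtain i k where ik: "i \<in> carrier H" "k \<in> carrier H" "i \<noteq> k" "\<pi> (\<delta> i a) = \<pi> (\<delta> k a)"
    unfolding inj_on_def by blast
  define j where "j = inv\<^bsub>H\<^esub> i \<otimes>\<^bsub>H\<^esub> k"
  have j: "j \<in> carrier H" "j \<noteq> \<one>\<^bsub>H\<^esub>"
    using ik H.inv_solve_left[of "\<one>\<^bsub>H\<^esub>" i k] by (auto simp: j_def)
  have e: "\<pi> (\<delta> \<one>\<^bsub>H\<^esub> a) = \<pi> (\<delta> j a)"
    using rep_\<delta>_translate[OF rep _ ik(1,2) a ik(4), of "inv\<^bsub>H\<^esub> i"] ik by (simp add: j_def)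
  have "\<pi> (\<delta> \<one>\<^bsub>H\<^esub> (a \<otimes>\<^bsub>L\<^esub> b)) = \<pi> (\<delta> j a) * \<pi> (\<delta> \<one>\<^bsub>H\<^esub> b)"
    using a b by (simp add: D(3) e flip: \<delta>_mult)
  also have "\<dots> = \<pi> (\<delta> \<one>\<^bsub>H\<^esub> b) * \<pi> (\<delta> j a)"
    using \<delta>_commute[OF j(1) H.one_closed j(2) a b] D(3)[of "\<delta> j a" "\<delta> \<one>\<^bsub>H\<^esub> b"] D(3)[of "\<delta> \<one>\<^bsub>H\<^esub> b" "\<delta> j a"] a b by simp
  also have "\<dots> = \<pi> (\<delta> \<one>\<^bsub>H\<^esub> (b \<otimes>\<^bsub>L\<^esub> a))"
    using a b by (simp add: D(3) e flip: \<delta>_mult)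
  finally show False using ne\<pi> by simp
qed

lemma separated_imp_base_separated:
  assumes "unitarily_separated fin W"
  shows "unitarily_separated fin L"
  unfolding unitarily_separated_def
proof (intro ballI impI)
  fix a assume a: "a \<in> carrier L" "a \<noteq> \<one>\<^bsub>L\<^esub>"
  have "\<delta> \<one>\<^bsub>H\<^esub> a \<noteq> \<delta> \<one>\<^bsub>H\<^esub> \<one>\<^bsub>L\<^esub>" using \<delta>_eq_iff[of "\<one>\<^bsub>H\<^esub>" "\<one>\<^bsub>H\<^esub>" a "\<one>\<^bsub>L\<^esub>"] a by simp
  moreover have "\<delta> \<one>\<^bsub>H\<^esub> \<one>\<^bsub>L\<^esub> = \<one>\<^bsub>W\<^esub>" by (auto simp: \<delta>_def one_W fun_eq_iff)
  ultimately show "\<exists>n \<pi>. unitary_rep L n \<pi> \<and> (fin \<longrightarrow> finite (\<pi> ` carrier L)) \<and> \<pi> a \<noteq> 1\<^sub>m n"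
    using separated_via_hom[OF assms \<delta>_hom a(1)] by simp
qed

text \<open>
  Invariance under \<open>N\<close> makes \<open>\<phi>\<close>, composed with the first projection, a homomorphism on the
  semidirect product of the base group with \<open>N\<close>. A representation of \<open>L\<close> pulled back along it
  is then induced to the wreath product; the index is finite because that of \<open>N\<close> is.
\<close>

lemma separated_by_invariant_hom:
  assumes sepL: "unitarily_separated fin L" and N: "finite_index N H"
    and \<phi>: "\<phi> \<in> hom S L"
    and inv: "\<And>f h. f \<in> carrier S \<Longrightarrow> h \<in> N \<Longrightarrow> \<phi> (shift_action H h f) = \<phi> f"
    and f: "f \<in> carrier S" and ne: "\<phi> f \<noteq> \<one>\<^bsub>L\<^esub>"
  shows "\<exists>n \<pi>. unitary_rep W n \<pi> \<and> (fin \<longrightarrow> finite (\<pi> ` carrier W)) \<and> \<pi> (f, \<one>\<^bsub>H\<^esub>) \<noteq> 1\<^sub>m n"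
proof -
  have Nsub: "subgroup N H" using N by (simp add: finite_index_def)
  interpret N: subgroup N H by (rule Nsub)
  define K where "K = {x \<in> carrier W. snd x \<in> N}"
  interpret snd: group_hom W H snd
    using snd_hom by (simp add: group_hom_def group_hom_axioms_def W.is_group H.is_group)
  have K: "subgroup K W"
  proof (rule W.subgroupI)
    have "\<one>\<^bsub>W\<^esub> \<in> K" by (simp add: K_def)
    then show "K \<noteq> {}" by blast
  qed (auto simp: K_def)
  have fiK: "finite_index K W"
  proof (rule W.finite_indexI[OF K])
    have "(\<lambda>x. snd x <#\<^bsub>H\<^esub> N) ` carrier W \<subseteq> (\<lambda>h. h <#\<^bsub>H\<^esub> N) ` carrier H" using snd.hom_closed by blast
    then show "finite ((\<lambda>x. snd x <#\<^bsub>H\<^esub> N) ` carrier W)"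
      by (rule finite_subset) (use N in \<open>simp add: finite_index_def\<close>)
    fix x y assume xy: "x \<in> carrier W" "y \<in> carrier W" "snd x <#\<^bsub>H\<^esub> N = snd y <#\<^bsub>H\<^esub> N"
    then show "inv\<^bsub>W\<^esub> x \<otimes>\<^bsub>W\<^esub> y \<in> K"
      using H.l_coset_eq_iff[OF Nsub snd.hom_closed snd.hom_closed] by (simp add: K_def)
  qed
  have "(\<lambda>x. \<phi> (fst x)) \<in> hom (W\<lparr>carrier := K\<rparr>) L"
    unfolding hom_def
  proof (intro CollectI conjI ballI Pi_I)
    fix x assume "x \<in> carrier (W\<lparr>carrier := K\<rparr>)"
    then show "\<phi> (fst x) \<in> carrier L"
      using \<phi> by (cases x) (auto simp: K_def carrier_W hom_def)
  next
    fix x y assume "x \<in> carrier (W\<lparr>carrier := K\<rparr>)" "y \<in> carrier (W\<lparr>carrier := K\<rparr>)"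
    then obtain u h v k where x: "x = (u, h)" "u \<in> carrier S" "h \<in> N" and y: "y = (v, k)" "v \<in> carrier S" "k \<in> N"
      by (cases x, cases y) (auto simp: K_def carrier_W)
    have "shift_action H h v \<in> carrier S"
      using shift_action_closed[OF L.is_group H.is_group] x y N.mem_carrier by blast
    then show "\<phi> (fst (x \<otimes>\<^bsub>W\<lparr>carrier := K\<rparr>\<^esub> y)) = \<phi> (fst x) \<otimes>\<^bsub>L\<^esub> \<phi> (fst y)"
      using x y \<phi> inv by (simp add: mult_W hom_mult[OF \<phi>] del: mult_sum_group)
  qed
  moreover have fK: "(f, \<one>\<^bsub>H\<^esub>) \<in> K" using f by (simp add: K_def carrier_W)
  ultimately obtain n \<sigma> where \<sigma>: "unitary_rep (W\<lparr>carrier := K\<rparr>) n \<sigma>" "fin \<longrightarrow> finite (\<sigma> ` K)" "\<sigma> (f, \<one>\<^bsub>H\<^esub>) \<noteq> 1\<^sub>m n"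
    using separated_via_hom[OF sepL, of "\<lambda>x. \<phi> (fst x)" "W\<lparr>carrier := K\<rparr>" "(f, \<one>\<^bsub>H\<^esub>)"] ne by auto
  obtain N' \<pi> where "unitary_rep W N' \<pi>" "finite (\<sigma> ` K) \<Longrightarrow> finite (\<pi> ` carrier W)"
    "\<And>g. g \<in> carrier W \<Longrightarrow> \<pi> g = 1\<^sub>m N' \<Longrightarrow> g \<in> K \<and> \<sigma> g = 1\<^sub>m n"
    using W.induced_rep[OF fiK \<sigma>(1)] by blast
  moreover have "(f, \<one>\<^bsub>H\<^esub>) \<in> carrier W" using f by (simp add: carrier_W)
  ultimately show ?thesis using \<sigma>(2,3) by blast
qed

text \<open>
  Multiplying up the entries over a right coset of \<open>N\<close> is an invariant homomorphism, because left
  multiplication by elements of \<open>N\<close> permutes such a coset. Commutativity of \<open>L\<close> makes it both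
  well defined and multiplicative.
\<close>

lemma coset_product_hom:
  assumes comm: "comm_group L" and N: "subgroup N H" and k: "k \<in> carrier H"
  shows "(\<lambda>f. gfinprod L f (N #>\<^bsub>H\<^esub> k)) \<in> hom S L"
    and "f \<in> carrier S \<Longrightarrow> h \<in> N \<Longrightarrow>
      gfinprod L (shift_action H h f) (N #>\<^bsub>H\<^esub> k) = gfinprod L f (N #>\<^bsub>H\<^esub> k)"
proof -
  interpret L: comm_group L by fact
  interpret N: subgroup N H by fact
  let ?A = "N #>\<^bsub>H\<^esub> k"
  have A: "?A \<subseteq> carrier H" using H.r_coset_subset_G[OF N.subset k] .
  have clos: "f \<in> ?A \<rightarrow> carrier L" if "f \<in> carrier S" for f using that A S_closed by blast
  have fin: "finite {x \<in> ?A. f x \<noteq> \<one>\<^bsub>L\<^esub>}" if "f \<in> carrier S" for f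
    by (rule finite_subset[of _ "{x \<in> carrier H. f x \<noteq> \<one>\<^bsub>L\<^esub>}"]) (use A that in \<open>auto simp: carrier_S\<close>)
  show "(\<lambda>f. gfinprod L f ?A) \<in> hom S L"
    unfolding hom_def
  proof (intro CollectI conjI ballI Pi_I)
    fix f assume "f \<in> carrier S"
    then show "gfinprod L f ?A \<in> carrier L" using clos by simp
  next
    fix f g assume fg: "f \<in> carrier S" "g \<in> carrier S"
    have "gfinprod L (f \<otimes>\<^bsub>S\<^esub> g) ?A = gfinprod L (\<lambda>x. f x \<otimes>\<^bsub>L\<^esub> g x) ?A"
      using A clos fg by (intro L.gfinprod_cong) (auto simp: simp_implies_def Pi_iff)
    also have "\<dots> = gfinprod L f ?A \<otimes>\<^bsub>L\<^esub> gfinprod L g ?A"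
      by (rule L.gfinprod_distrib) (use fin clos fg in auto)
    finally show "gfinprod L (f \<otimes>\<^bsub>S\<^esub> g) ?A = gfinprod L f ?A \<otimes>\<^bsub>L\<^esub> gfinprod L g ?A" .
  qed
  assume f: "f \<in> carrier S" and h: "h \<in> N"
  have hH: "h \<in> carrier H" using h N.mem_carrier by blast
  have move: "l \<otimes>\<^bsub>H\<^esub> x \<in> ?A" if l: "l \<in> N" and x: "x \<in> ?A" for l x
  proof -
    obtain m where m: "m \<in> N" "x = m \<otimes>\<^bsub>H\<^esub> k" using x by (auto simp: r_coset_def)
    have "l \<otimes>\<^bsub>H\<^esub> x = (l \<otimes>\<^bsub>H\<^esub> m) \<otimes>\<^bsub>H\<^esub> k" using l m k by (simp add: H.m_assoc)
    moreover have "l \<otimes>\<^bsub>H\<^esub> m \<in> N" using l m by simp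
    ultimately show ?thesis unfolding r_coset_def by blast
  qed
  let ?g = "shift_action H h f"
  have gx: "?g (h \<otimes>\<^bsub>H\<^esub> x) = f x" if "x \<in> carrier H" for x
    using that hH by (simp add: shift_action_def flip: H.m_assoc)
  have im: "{x \<in> ?A. ?g x \<noteq> \<one>\<^bsub>L\<^esub>} = (\<lambda>x. h \<otimes>\<^bsub>H\<^esub> x) ` {x \<in> ?A. f x \<noteq> \<one>\<^bsub>L\<^esub>}"
  proof (intro equalityI subsetI)
    fix x assume x: "x \<in> {x \<in> ?A. ?g x \<noteq> \<one>\<^bsub>L\<^esub>}"
    then have xH: "x \<in> carrier H" using A by blast
    have e: "x = h \<otimes>\<^bsub>H\<^esub> (inv\<^bsub>H\<^esub> h \<otimes>\<^bsub>H\<^esub> x)" using xH hH by (simp flip: H.m_assoc)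
    moreover have "inv\<^bsub>H\<^esub> h \<otimes>\<^bsub>H\<^esub> x \<in> ?A" using move x h by simp
    moreover have "f (inv\<^bsub>H\<^esub> h \<otimes>\<^bsub>H\<^esub> x) \<noteq> \<one>\<^bsub>L\<^esub>" using x xH by (simp add: shift_action_def)
    ultimately show "x \<in> (\<lambda>x. h \<otimes>\<^bsub>H\<^esub> x) ` {x \<in> ?A. f x \<noteq> \<one>\<^bsub>L\<^esub>}" by blast
  next
    fix x assume "x \<in> (\<lambda>x. h \<otimes>\<^bsub>H\<^esub> x) ` {x \<in> ?A. f x \<noteq> \<one>\<^bsub>L\<^esub>}"
    then show "x \<in> {x \<in> ?A. ?g x \<noteq> \<one>\<^bsub>L\<^esub>}" using move[OF h] gx A by auto
  qed
  have "finprod L ?g ((\<lambda>x. h \<otimes>\<^bsub>H\<^esub> x) ` {x \<in> ?A. f x \<noteq> \<one>\<^bsub>L\<^esub>})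
      = finprod L (\<lambda>x. ?g (h \<otimes>\<^bsub>H\<^esub> x)) {x \<in> ?A. f x \<noteq> \<one>\<^bsub>L\<^esub>}"
  proof (rule L.finprod_reindex)
    show "?g \<in> (\<lambda>x. h \<otimes>\<^bsub>H\<^esub> x) ` {x \<in> ?A. f x \<noteq> \<one>\<^bsub>L\<^esub>} \<rightarrow> carrier L"
      using gx A S_closed[OF f] by auto
    show "inj_on (\<lambda>x. h \<otimes>\<^bsub>H\<^esub> x) {x \<in> ?A. f x \<noteq> \<one>\<^bsub>L\<^esub>}"
      by (rule inj_on_inverseI[where g = "\<lambda>x. inv\<^bsub>H\<^esub> h \<otimes>\<^bsub>H\<^esub> x"])
        (use A hH in \<open>auto simp flip: H.m_assoc\<close>)
  qed
  also have "\<dots> = finprod L f {x \<in> ?A. f x \<noteq> \<one>\<^bsub>L\<^esub>}"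
    using gx A S_closed[OF f] by (intro L.finprod_cong') auto
  finally show "gfinprod L ?g ?A = gfinprod L f ?A"
    unfolding gfinprod_def im using fin[OF f] by simp
qed

text \<open>
  With \<open>T\<close> the support of a family, the product over the coset of \<open>k\<close> reduces to the single entry
  at \<open>k\<close>. Residual finiteness gives, for every other \<open>y\<close> in \<open>T\<close>, a subgroup excluding \<open>y\<close> times the inverse of \<open>k\<close>; take
  the intersection.
\<close>

lemma separate_support:
  assumes RF: "unitarily_separated True H" and k: "k \<in> carrier H"
    and T: "finite T" "T \<subseteq> carrier H"
  obtains N where "finite_index N H" "(N #>\<^bsub>H\<^esub> k) \<inter> T \<subseteq> {k}"
proof -
  have "\<exists>M. finite_index M H \<and> y \<otimes>\<^bsub>H\<^esub> inv\<^bsub>H\<^esub> k \<notin> M" if y: "y \<in> T - {k}" for y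
  proof -
    have "y \<in> carrier H" using y T by blast
    moreover have "y \<otimes>\<^bsub>H\<^esub> inv\<^bsub>H\<^esub> k \<noteq> \<one>\<^bsub>H\<^esub>"
      using y k \<open>y \<in> carrier H\<close> H.inv_solve_right[of "\<one>\<^bsub>H\<^esub>" y k] by auto
    ultimately show ?thesis using RF k unfolding H.separated_iff_finite_index by simp
  qed
  then obtain M where M: "\<And>y. y \<in> T - {k} \<Longrightarrow> finite_index (M y) H \<and> y \<otimes>\<^bsub>H\<^esub> inv\<^bsub>H\<^esub> k \<notin> M y"
    by metis
  then have Ms: "\<And>y. y \<in> T - {k} \<Longrightarrow> subgroup (M y) H" by (simp add: finite_index_def)
  define N where "N = {h \<in> carrier H. \<forall>y\<in>T - {k}. h \<in> M y}"
  have "\<one>\<^bsub>H\<^esub> \<in> N" using Ms by (auto simp: N_def subgroup.one_closed)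
  then have "N \<noteq> {}" by blast
  then have N: "subgroup N H"
    by (intro H.subgroupI) (use Ms in \<open>auto simp: N_def subgroup.one_closed subgroup.m_inv_closed subgroup.m_closed\<close>)
  have "finite_index N H"
  proof (rule H.finite_indexI[OF N])
    have "(\<lambda>h. \<lambda>y\<in>T - {k}. h <#\<^bsub>H\<^esub> M y) ` carrier H \<subseteq> (\<Pi>\<^sub>E y\<in>T - {k}. (\<lambda>h. h <#\<^bsub>H\<^esub> M y) ` carrier H)"
      by auto
    moreover have "finite (\<Pi>\<^sub>E y\<in>T - {k}. (\<lambda>h. h <#\<^bsub>H\<^esub> M y) ` carrier H)"
      by (rule finite_PiE) (use T M in \<open>auto simp: finite_index_def\<close>)
    ultimately show "finite ((\<lambda>h. \<lambda>y\<in>T - {k}. h <#\<^bsub>H\<^esub> M y) ` carrier H)" by (rule finite_subset)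
    fix g h assume gh: "g \<in> carrier H" "h \<in> carrier H"
      and eq: "(\<lambda>y\<in>T - {k}. g <#\<^bsub>H\<^esub> M y) = (\<lambda>y\<in>T - {k}. h <#\<^bsub>H\<^esub> M y)"
    have "g <#\<^bsub>H\<^esub> M y = h <#\<^bsub>H\<^esub> M y" if "y \<in> T - {k}" for y
      using fun_cong[OF eq, of y] that by simp
    then show "inv\<^bsub>H\<^esub> g \<otimes>\<^bsub>H\<^esub> h \<in> N"
      using gh H.l_coset_eq_iff[OF Ms] by (auto simp: N_def)
  qed
  moreover have "(N #>\<^bsub>H\<^esub> k) \<inter> T \<subseteq> {k}"
  proof
    fix y assume y: "y \<in> (N #>\<^bsub>H\<^esub> k) \<inter> T"
    then obtain n where n: "n \<in> N" "y = n \<otimes>\<^bsub>H\<^esub> k" by (auto simp: r_coset_def)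
    then have "y \<otimes>\<^bsub>H\<^esub> inv\<^bsub>H\<^esub> k = n" using k by (simp add: N_def H.m_assoc)
    then show "y \<in> {k}" using M[of y] n y by (auto simp: N_def)
  qed
  ultimately show thesis by (rule that)
qed

text \<open>
  An element with nontrivial \<open>H\<close> component is seen by \<open>H\<close>, even with finite image. Otherwise some entry
  \<open>f k\<close> is nontrivial, and an invariant homomorphism to \<open>L\<close> isolates it: evaluation at \<open>k\<close> with
  \<open>N\<close> trivial if \<open>H\<close> is finite, and the product over a small coset of \<open>k\<close> if \<open>L\<close> is abelian.
\<close>

lemma separated_wreath:
  assumes sepL: "unitarily_separated fin L" and sepH: "unitarily_separated True H"
    and alt: "finite (carrier H) \<or> comm_group L"
  shows "unitarily_separated fin W"
  unfolding unitarily_separated_def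
proof (intro ballI impI)
  fix g assume g: "g \<in> carrier W" "g \<noteq> \<one>\<^bsub>W\<^esub>"
  obtain f h where fh: "g = (f, h)" by (cases g)
  have f: "f \<in> carrier S" and h: "h \<in> carrier H" using g fh by (auto simp: carrier_W)
  show "\<exists>n \<pi>. unitary_rep W n \<pi> \<and> (fin \<longrightarrow> finite (\<pi> ` carrier W)) \<and> \<pi> g \<noteq> 1\<^sub>m n"
  proof (cases "h = \<one>\<^bsub>H\<^esub>")
    case False
    then show ?thesis
      using separated_via_hom[OF unitarily_separated_mono[OF sepH] snd_hom g(1)] fh by simp
  next
    case True
    have "f \<noteq> \<one>\<^bsub>S\<^esub>" using g True fh by (auto simp: one_W)
    then obtain k where k: "k \<in> carrier H" "f k \<noteq> \<one>\<^bsub>L\<^esub>"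
      using f by (auto simp: carrier_S fun_eq_iff PiE_iff extensional_def split: if_splits)
    show ?thesis
    proof (cases "comm_group L")
      case comm: True
      interpret L: comm_group L by fact
      define T where "T = {y \<in> carrier H. f y \<noteq> \<one>\<^bsub>L\<^esub>}"
      have "finite T" "T \<subseteq> carrier H" using f by (auto simp: T_def carrier_S)
      then obtain N where N: "finite_index N H" and NT: "(N #>\<^bsub>H\<^esub> k) \<inter> T \<subseteq> {k}"
        using separate_support[OF sepH k(1)] by blast
      have Ns: "subgroup N H" using N by (simp add: finite_index_def)
      have kA: "k \<in> N #>\<^bsub>H\<^esub> k" by (rule H.rcos_self[OF k(1) Ns])
      have AH: "N #>\<^bsub>H\<^esub> k \<subseteq> carrier H" by (rule H.r_coset_subset_G[OF subgroup.subset[OF Ns] k(1)])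
      have "gfinprod L f (N #>\<^bsub>H\<^esub> k) = gfinprod L f {k}"
      proof (rule L.gfinprod_mono_neutral_cong_right)
        show "f i = \<one>\<^bsub>L\<^esub>" if "i \<in> (N #>\<^bsub>H\<^esub> k) - {k}" for i
          using that NT AH unfolding T_def by blast
      qed (use kA AH S_closed[OF f] in auto)
      also have "\<dots> = f k" using S_closed[OF f k(1)] by simp
      finally have "gfinprod L f (N #>\<^bsub>H\<^esub> k) \<noteq> \<one>\<^bsub>L\<^esub>" using k by simp
      then show ?thesis
        unfolding fh True
        by (intro separated_by_invariant_hom[OF sepL N coset_product_hom(1)[OF comm Ns k(1)]
              coset_product_hom(2)[OF comm Ns k(1)] f])
    next
      case False
      then have fin: "finite (carrier H)" using alt by blast
      have triv: "subgroup {\<one>\<^bsub>H\<^esub>} H" by (rule H.subgroupI) auto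
      have N: "finite_index {\<one>\<^bsub>H\<^esub>} H" using triv fin by (simp add: finite_index_def)
      have "(\<lambda>f. f k) \<in> hom S L" using k S_closed by (auto simp: hom_def)
      then show ?thesis
        unfolding fh True
        using shift_id by (intro separated_by_invariant_hom[where \<phi> = "\<lambda>f. f k", OF sepL N] f k(2)) auto
    qed
  qed
qed

theorem separated_wreath_iff:
  assumes "\<exists>x\<in>carrier L. \<exists>y\<in>carrier L. x \<noteq> y"
  shows "unitarily_separated fin W \<longleftrightarrow>
    unitarily_separated fin L \<and> unitarily_separated True H \<and> (finite (carrier H) \<or> comm_group L)"
  using separated_wreath separated_imp_base_separated separated_imp_base_abelian
    separated_imp_top_residually_finite[OF _ assms] by blast

end

theorem corollary7:
  fixes L :: "('a, 'b) monoid_scheme" and H :: "('c, 'd) monoid_scheme"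
  assumes "group L" and "group H"
    and "countable (carrier L)" and "countable (carrier H)"
    and "\<exists>x\<in>carrier L. \<exists>y\<in>carrier L. x \<noteq> y"
  shows "(maximally_almost_periodic (wreath_product L H) \<longleftrightarrow>
            maximally_almost_periodic L \<and> residually_finite H \<and>
            (finite (carrier H) \<or> comm_group L)) \<and>
         (residually_finite (wreath_product L H) \<longleftrightarrow>
            residually_finite L \<and> residually_finite H \<and>
            (finite (carrier H) \<or> comm_group L))"
proof -
  interpret wreath L H using assms by (simp add: wreath_def)
  show ?thesis
    unfolding maximally_almost_periodic_iff[OF L.is_group] maximally_almost_periodic_iff[OF W.is_group] residually_finite_iff[OF L.is_group] residually_finite_iff[OF H.is_group] residually_finite_iff[OF W.is_group]
    using separated_wreath_iff[OF assms(5)] by blast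
qed

end
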